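(* Let $a,b,c,c'\in\mathbb{C}$ satisfy $$c,c'\notin\mathbb{Z}_{\leqslant 0},\qquad a-b\notin\mathbb{Z},\qquad a-c\notin\mathbb{Z},\qquad \operatorname{Re}(c-b)>0,$$ and let $0<\gamma_1\leqslant\gamma_2<\infty$ be fixed. Then, as $$x\to\infty,\qquad |\arg(1-x)|<\pi,\qquad y\to+\infty,\qquad \gamma_1\leqslant\biggl|\frac{y}{1-x}\biggr|\leqslant\gamma_2,$$ one has $$\Psi_1[a,b;c,c';x,y]\sim\frac{\Gamma(c)\Gamma(c')}{\Gamma(a)\Gamma(c-b)}\biggl(\frac{y}{1-x}\biggr)^{b}y^{a-2b-c'}\mathrm{e}^{y}.$$
   Context: Here $x$ is complex and $y$ is real positive and large; powers are principal values. The Humbert function $\Psi_1$ is defined for $a,b\in\mathbb{C}$, $c,c'\notin\mathbb{Z}_{\leqslant 0}$ by $$\Psi_1[a,b;c,c';x,y]=\sum_{m,n=0}^{\infty}\frac{(a)_{m+n}(b)_m}{(c)_m(c')_n}\frac{x^m}{m!}\frac{y^n}{n!},\qquad |x|<1,\ |y|<\infty,$$ where $(\cdot)_n$ is the Pochhammer symbol, and it is analytically continued to $\{(x,y)\in\mathbb{C}^2: x\neq1,\ |\arg(1-x)|<\pi,\ |y|<\infty\}$ by $$\Psi_1[a,b;c,c';x,y]=\sum_{n=0}^{\infty}\frac{(a)_n}{(c')_n}\,{}_2F_1\biggl[\begin{matrix}a+n,b\\ c\end{matrix};x\biggr]\frac{y^n}{n!},$$ where ${}_2F_1$ is the principal branch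 of the Gauss hypergeometric function, analytic on $|\arg(1-x)|<\pi$.
   Formalization: For a a non-positive integer, 1/Γ(a)=0 and the stated ~ fails (a=0 gives Ψ₁=1); the formal theorem asserts ~ only for a not a non-positive integer, and otherwise that Ψ₁ = o((y/(1-x))^b y^{a-2b-c'} e^y). *)

theory Defs
  imports "HOL-Complex_Analysis.Complex_Analysis" "HOL-Library.Landau_Symbols"
begin

(* "x \<noteq> 1" is needed because Arg 0 = 0. *)
definition cut_plane :: "complex set" where
  "cut_plane = {x. x \<noteq> 1 \<and> \<bar>Arg (1 - x)\<bar> < pi}"

(* Principal branch of 2F1: the analytic continuation of the Gauss series from the unit disc
   to the cut plane.  As the cut plane is connected, the values there do not depend on the
   choice made by SOME; the values on the cut are unspecified. *)
definition hyp2f1 :: "complex \<Rightarrow> complex \<Rightarrow> complex \<Rightarrow> complex \<Rightarrow> complex" where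
  "hyp2f1 a b c = (SOME F. F holomorphic_on cut_plane \<and>
                           (\<forall>x. norm x < 1 \<longrightarrow> F x = eval_fps (fps_hypergeo [a, b] [c] 1) x))"

(* The Humbert function Psi_1[a, b; c, c'; x, y] for x in the cut plane, given by the single
   series that continues the double series
     \<Sum>m n. (a)_(m+n) (b)_m / ((c)_m (c')_n) * x^m / m! * y^n / n!      (norm x < 1);
   summing the double series over m first yields the terms below. *)
definition humbert_psi1 ::
    "complex \<Rightarrow> complex \<Rightarrow> complex \<Rightarrow> complex \<Rightarrow> complex \<Rightarrow> complex \<Rightarrow> complex" where
  "humbert_psi1 a b c c' x y =
     (\<Sum>n. pochhammer a n / pochhammer c' n * hyp2f1 (a + of_nat n) b c x * (y ^ n / fact n))"

(* x \<rightarrow> \<infinity> in the cut plane and y \<rightarrow> +\<infinity>, jointly, with \<gamma>1 \<le> |y / (1 - x)| \<le> \<gamma>2.  Limits along this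
   filter are uniform in arg (1 - x) and in the ratio y / (1 - x). *)
definition psi1_regime :: "real \<Rightarrow> real \<Rightarrow> (complex \<times> real) filter" where
  "psi1_regime \<gamma>1 \<gamma>2 =
     inf (at_infinity \<times>\<^sub>F at_top)
         (principal {(x, y). x \<in> cut_plane \<and>
            \<gamma>1 \<le> norm (complex_of_real y / (1 - x)) \<and> norm (complex_of_real y / (1 - x)) \<le> \<gamma>2})"

end

theory Submission
  imports Defs
begin

text \<open>
  Write \<^term>\<open>w = 1 - x\<close>. The asymptotics are those of a Poisson average. Pfaff's form of Euler's
  integral,
    \<open>F(a + n, b; c; x) = w\<^sup>-\<^sup>b B(b, c - b)\<^sup>-\<^sup>1 \<integral> s\<^sup>b\<^sup>-\<^sup>1 (1 - s)\<^sup>c\<^sup>-\<^sup>b\<^sup>-\<^sup>1 (1 - s + s / w)\<^sup>a\<^sup>+\<^sup>n\<^sup>-\<^sup>c ds\<close>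
  over the unit interval, has an integrand that concentrates at \<open>s\<close> of order \<open>1 / n\<close>, where the last
  factor is close to \<open>exp (- n s)\<close> as soon as \<open>w\<close> is large, too. So
  \<open>(n w)\<^sup>b F(a + n, b; c; x)\<close> tends to \<open>\<Gamma>(c) / \<Gamma>(c - b)\<close> as \<open>n\<close> and \<open>x\<close> tend to infinity
  independently (\<open>hyp2f1_asymptotic\<close>). The convergence is uniform up to the cut because
  \<open>1 - s + s / w\<close> is bounded by \<open>1 - s + s / |w|\<close> whatever the argument of \<open>w\<close>. As
  \<open>(a)\<^sub>n / (c')\<^sub>n\<close> behaves like \<open>\<Gamma>(c') / \<Gamma>(a)\<close> times the power \<open>a - c'\<close> of \<open>n\<close>, the terms of the
  Humbert series with large \<open>n\<close> are asymptotic to a constant times \<open>w\<^sup>-\<^sup>b\<close>, the power \<open>a - b - c'\<close> of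
  \<open>n\<close>, and the Poisson weight \<open>y\<^sup>n / n!\<close>. These weights have total mass \<open>exp y\<close> and concentrate at
  indices close to \<open>y\<close>, so that \<open>n\<close> may be replaced by \<open>y\<close> in the power
  (\<open>poisson_average_tendsto\<close>), which gives the main term.

  The terms with \<open>n\<close> far from \<open>y\<close> carry an exponentially small part of the mass. For them a bound
  that is polynomial in \<open>n\<close> and \<open>|w|\<close> suffices (\<open>poly_bounded_hyp2f1\<close>), since \<open>|w|\<close> is at most a
  multiple of \<open>y\<close>. The integral gives such a bound for all but finitely many \<open>n\<close>; for the others
  the real part of \<open>a + n - c\<close> is negative, the integrand is unbounded near the cut, and a
  three-term relation in the first parameter takes over.

  The integral makes sense only if the real parts of \<open>b\<close> and \<open>c - b\<close> are positive. Two contiguous relations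
  raise these parameters by 1, and the existence of the continuation to the cut plane, the limit and
  the bound all pass through them (\<open>raise_b_c_induct\<close>). Hence each of the three is proved from the
  integral for real parts above 1, where the integrand is continuous.

  With the entire function \<open>1 / \<Gamma>\<close> in place of the quotient, the limit of the scaled Humbert function
  keeps its form when \<open>a\<close> is a non-positive integer: its value is then 0, which is the little-o statement.
\<close>

section \<open>The cut plane and the Gauss series\<close>

lemma cut_plane_iff: "x \<in> cut_plane \<longleftrightarrow> 1 - x \<notin> \<real>\<^sub>\<le>\<^sub>0"
proof -
  have "\<bar>Arg (1 - x)\<bar> < pi \<longleftrightarrow> Arg (1 - x) \<noteq> pi"
    using Arg_bounded[of "1 - x"] by auto
  then show ?thesis
    by (auto simp: cut_plane_def Arg_eq_pi complex_nonpos_Reals_iff complex_eq_iff)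
qed

lemma cut_plane_eq_image: "cut_plane = (\<lambda>w. 1 - w) ` (- \<real>\<^sub>\<le>\<^sub>0)"
proof (intro set_eqI iffI)
  fix x assume "x \<in> cut_plane"
  then show "x \<in> (\<lambda>w. 1 - w) ` (- \<real>\<^sub>\<le>\<^sub>0)"
    by (intro image_eqI[of _ _ "1 - x"]) (auto simp: cut_plane_iff)
qed (auto simp: cut_plane_iff)

lemma open_cut_plane: "open cut_plane"
proof -
  have "cut_plane = (\<lambda>x. 1 - x) -` (- \<real>\<^sub>\<le>\<^sub>0)"
    by (auto simp: cut_plane_iff)
  moreover have "open ((\<lambda>x. 1 - x) -` (- \<real>\<^sub>\<le>\<^sub>0 :: complex set))"
    by (intro open_vimage continuous_intros) (simp add: open_Compl)
  ultimately show ?thesis by simp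
qed

text \<open>
  The cut plane is a reflected copy of the plane slit along the negative real axis, which is
  starlike.
\<close>

lemma connected_cut_plane: "connected cut_plane"
proof -
  have "- \<real>\<^sub>\<le>\<^sub>0 = - (complex_of_real ` {..0})"
    by (auto simp: nonpos_Reals_def)
  then have "connected (- \<real>\<^sub>\<le>\<^sub>0 :: complex set)"
    using starlike_imp_connected[OF starlike_slotted_complex_plane_left[of 0]] by simp
  then show ?thesis
    unfolding cut_plane_eq_image by (intro connected_continuous_image continuous_intros)
qed

lemma unit_disc_subset_cut_plane: "ball 0 1 \<subseteq> cut_plane"
proof
  fix x :: complex assume "x \<in> ball 0 1"
  then have "Re x < 1"
    using complex_Re_le_cmod[of x] by auto
  then show "x \<in> cut_plane"
    by (auto simp: cut_plane_iff complex_nonpos_Reals_iff)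
qed

definition gauss_coeff :: "complex \<Rightarrow> complex \<Rightarrow> complex \<Rightarrow> nat \<Rightarrow> complex" where
  "gauss_coeff a b c m = pochhammer a m * pochhammer b m / (pochhammer c m * fact m)"

lemma pochhammer_not_nonpos_Int: "c \<notin> \<int>\<^sub>\<le>\<^sub>0 \<Longrightarrow> pochhammer (c::complex) m \<noteq> 0"
  by (auto simp: pochhammer_eq_0_iff)

lemma plus_nat_not_nonpos_Int:
  assumes "c \<notin> \<int>\<^sub>\<le>\<^sub>0" shows "c + of_nat n \<notin> (\<int>\<^sub>\<le>\<^sub>0 :: complex set)"
proof
  assume "c + of_nat n \<in> \<int>\<^sub>\<le>\<^sub>0"
  then obtain k where "c + of_nat n = - of_nat k" by (elim nonpos_Ints_cases')
  then have "c = - of_nat (k + n)" by (simp add: algebra_simps add_eq_0_iff)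
  with assms show False by (metis minus_of_nat_in_nonpos_Ints)
qed

lemma plus_nat_neq_0:
  assumes "c \<notin> \<int>\<^sub>\<le>\<^sub>0" shows "c + of_nat n \<noteq> (0::complex)"
  using plus_nat_not_nonpos_Int[OF assms, of n] by auto

lemma gauss_coeff_Suc:
  "gauss_coeff a b c (Suc m) =
     gauss_coeff a b c m * ((a + of_nat m) * (b + of_nat m) / ((c + of_nat m) * of_nat (Suc m)))"
  by (simp add: gauss_coeff_def pochhammer_Suc mult_ac)

lemma of_nat_shift_ratio_tendsto_1: "(\<lambda>n. (u + of_nat n) / (v + of_nat n) :: complex) \<longlonglongrightarrow> 1"
proof -
  have "(\<lambda>n. (u / of_nat n + 1) / (v / of_nat n + 1)) \<longlonglongrightarrow> (0 + 1) / (0 + 1 :: complex)"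
    by (intro tendsto_intros lim_const_over_n) auto
  moreover have "eventually (\<lambda>n. (u / of_nat n + 1) / (v / of_nat n + 1) =
      (u + of_nat n) / (v + of_nat n)) sequentially"
    using eventually_gt_at_top[of 0] 
  proof eventually_elim
    case (elim n)
    then have "w / of_nat n + 1 = (w + of_nat n) / of_nat n" for w :: complex
      by (simp add: add_divide_distrib)
    with elim show ?case by simp
  qed
  ultimately show ?thesis using tendsto_cong by fastforce
qed

lemma summable_gauss:
  assumes "norm x < 1"
  shows "summable (\<lambda>m. gauss_coeff a b c m * x ^ m)"
proof -
  let ?r = "\<lambda>m. ((a + of_nat m) / (c + of_nat m)) * ((b + of_nat m) / (1 + of_nat m)) * x"
  have "(\<lambda>m. norm (?r m)) \<longlonglongrightarrow> norm (1 * 1 * x)"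
    by (intro tendsto_intros of_nat_shift_ratio_tendsto_1)
  moreover obtain q where q: "norm x < q" "q < 1" using dense[OF assms] by blast
  ultimately have "eventually (\<lambda>m. norm (?r m) < q) sequentially"
    by (intro order_tendstoD) auto
  then obtain N where N: "\<And>m. m \<ge> N \<Longrightarrow> norm (?r m) < q"
    by (auto simp: eventually_at_top_linorder)
  show ?thesis
  proof (rule summable_ratio_test[OF \<open>q < 1\<close>])
    fix m assume "m \<ge> N"
    have "gauss_coeff a b c (Suc m) * x ^ Suc m = ?r m * (gauss_coeff a b c m * x ^ m)"
      by (simp add: gauss_coeff_Suc field_simps)
    then have "norm (gauss_coeff a b c (Suc m) * x ^ Suc m) =
        norm (?r m) * norm (gauss_coeff a b c m * x ^ m)"
      by (simp only: norm_mult)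
    also have "\<dots> \<le> q * norm (gauss_coeff a b c m * x ^ m)"
      using N[OF \<open>m \<ge> N\<close>] by (intro mult_right_mono) auto
    finally show "norm (gauss_coeff a b c (Suc m) * x ^ Suc m) \<le>
        q * norm (gauss_coeff a b c m * x ^ m)" .
  qed
qed

lemma fps_hypergeo_nth_gauss_coeff: "fps_nth (fps_hypergeo [a, b] [c] 1) m = gauss_coeff a b c m"
  by (simp add: gauss_coeff_def)

definition gauss_series :: "complex \<Rightarrow> complex \<Rightarrow> complex \<Rightarrow> complex \<Rightarrow> complex" where
  "gauss_series a b c x = eval_fps (fps_hypergeo [a, b] [c] 1) x"

lemma gauss_series_sums:
  assumes "norm x < 1"
  shows "(\<lambda>m. gauss_coeff a b c m * x ^ m) sums gauss_series a b c x"
  unfolding gauss_series_def eval_fps_def fps_hypergeo_nth_gauss_coeff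
  by (intro summable_sums summable_gauss assms)

lemma holomorphic_gauss_series: "gauss_series a b c holomorphic_on ball 0 1"
proof -
  have "fps_conv_radius (fps_hypergeo [a, b] [c] 1) \<ge> 1"
  proof (rule ccontr)
    assume "\<not> ?thesis"
    then have "fps_conv_radius (fps_hypergeo [a, b] [c] 1) < 1" by simp
    then obtain r where r: "fps_conv_radius (fps_hypergeo [a, b] [c] 1) < ereal r" "r < 1"
      using ereal_dense2 by (metis ereal_less(3) one_ereal_def)
    have "r > 0"
      using r(1) fps_conv_radius_def conv_radius_nonneg by (metis ereal_less(2) order_le_less_trans)
    have "summable (\<lambda>m. gauss_coeff a b c m * of_real r ^ m)"
      by (rule summable_gauss) (use \<open>r > 0\<close> r in auto)
    then have "conv_radius (gauss_coeff a b c) \<ge> norm (complex_of_real r)"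
      by (rule conv_radius_geI)
    with r(1) \<open>r > 0\<close> show False
      by (simp add: fps_conv_radius_def fps_hypergeo_nth_gauss_coeff del: fps_hypergeo_nth)
  qed
  then have "ball (0::complex) 1 \<subseteq> eball 0 (fps_conv_radius (fps_hypergeo [a, b] [c] 1))"
    by (auto simp: eball_def zero_ereal_def one_ereal_def dist_commute order_less_le_trans
             intro: order_less_le_trans[of _ "ereal 1"])
  then show ?thesis
    unfolding gauss_series_def[abs_def] by (intro holomorphic_intros) auto
qed

definition continues_gauss_series ::
    "complex \<Rightarrow> complex \<Rightarrow> complex \<Rightarrow> (complex \<Rightarrow> complex) \<Rightarrow> bool" where
  "continues_gauss_series a b c F \<longleftrightarrow>
     F holomorphic_on cut_plane \<and> (\<forall>x. norm x < 1 \<longrightarrow> F x = gauss_series a b c x)"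

lemma continues_gauss_series_hyp2f1:
  assumes "continues_gauss_series a b c F"
  shows "continues_gauss_series a b c (hyp2f1 a b c)"
  using assms someI[of "\<lambda>F. continues_gauss_series a b c F" F]
  by (simp add: continues_gauss_series_def hyp2f1_def gauss_series_def)

text \<open>
  The identity theorem: this is what makes the choice in the definition of \<^term>\<open>hyp2f1\<close> harmless,
  and it turns every identity between Gauss series into one on the whole cut plane.
\<close>

lemma continues_gauss_series_unique:
  assumes F: "continues_gauss_series a b c F" and G: "continues_gauss_series a b c G"
    and x: "x \<in> cut_plane"
  shows "F x = G x"
proof (rule analytic_continuation_open[of "ball 0 1" cut_plane F G])
qed (use F G in \<open>simp_all add: continues_gauss_series_def open_cut_plane connected_cut_plane
       unit_disc_subset_cut_plane x\<close>)

lemma hyp2f1_eqI: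
  assumes "continues_gauss_series a b c F" and "x \<in> cut_plane"
  shows "hyp2f1 a b c x = F x"
  using continues_gauss_series_unique[OF continues_gauss_series_hyp2f1] assms by blast

text \<open>
  The Pfaff integral represents the hypergeometric function only for \<^term>\<open>Re b > 0\<close> and
  \<^term>\<open>Re (c - b) > 0\<close>, and its integrand is continuous on the closed interval only when these
  real parts exceed 1. The contiguous relations \<open>gauss_series_raise_c\<close> and \<open>gauss_series_raise_b\<close> express
  the function through functions whose parameters lie further to the right: the first raises
  \<^term>\<open>Re (c - b)\<close> without lowering \<^term>\<open>Re b\<close>, the second raises \<^term>\<open>Re b\<close> without lowering
  \<^term>\<open>Re (c - b)\<close>. So a property that passes through both relations
  need only be checked where the integral is continuous.
\<close>

lemma raise_b_c_induct [consumes 1, case_names base raise_c raise_b]: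
  fixes P :: "complex \<Rightarrow> complex \<Rightarrow> complex \<Rightarrow> bool"
  assumes c: "c \<notin> \<int>\<^sub>\<le>\<^sub>0"
    and base: "\<And>a b c. c \<notin> \<int>\<^sub>\<le>\<^sub>0 \<Longrightarrow> Re b > 1 \<Longrightarrow> Re (c - b) > 1 \<Longrightarrow> P a b c"
    and raise_c: "\<And>a b c. c \<notin> \<int>\<^sub>\<le>\<^sub>0 \<Longrightarrow> P a b (c + 1) \<Longrightarrow> P (a + 1) (b + 1) (c + 2) \<Longrightarrow> P a b c"
    and raise_b: "\<And>a b c. c \<notin> \<int>\<^sub>\<le>\<^sub>0 \<Longrightarrow> P a (b + 1) (c + 1) \<Longrightarrow> P (a + 1) (b + 1) (c + 2) \<Longrightarrow>
                     P a b c"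
  shows "P a b c"
proof -
  have c1: "c + 1 \<notin> \<int>\<^sub>\<le>\<^sub>0" and c2: "c + 2 \<notin> \<int>\<^sub>\<le>\<^sub>0" if "c \<notin> \<int>\<^sub>\<le>\<^sub>0" for c :: complex
    using plus_nat_not_nonpos_Int[OF that, of 1] plus_nat_not_nonpos_Int[OF that, of 2] by auto
  have *: "P a b c" if "c \<notin> \<int>\<^sub>\<le>\<^sub>0" "Re b > 1" "Re (c - b) > 1 - real k" for k a b c
    using that
  proof (induction k arbitrary: a b c)
    case 0
    then show ?case by (intro base) auto
  next
    case (Suc k)
    show ?case
      by (rule raise_c; (rule Suc.IH)?) (use Suc.prems c1 c2 in auto)
  qed
  have **: "P a b c" if "c \<notin> \<int>\<^sub>\<le>\<^sub>0" "Re b > 1 - real k" for k a b c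
    using that
  proof (induction k arbitrary: a b c)
    case 0
    obtain k where "real k > 1 - Re (c - b)" using reals_Archimedean2 by blast
    then show ?case using *[of c b k a] 0 by auto
  next
    case (Suc k)
    show ?case
      by (rule raise_b; (rule Suc.IH)?) (use Suc.prems c1 c2 in auto)
  qed
  obtain k where "real k > 1 - Re b" using reals_Archimedean2 by blast
  then show ?thesis using **[of c k b a] c by auto
qed


lemma sums_times_x:
  fixes f :: "nat \<Rightarrow> complex"
  assumes "(\<lambda>m. f m * x ^ m) sums s"
  shows "(\<lambda>m. (case m of 0 \<Rightarrow> 0 | Suc k \<Rightarrow> f k) * x ^ m) sums (x * s)"
proof -
  have "(\<lambda>m. x * (f m * x ^ m)) sums (x * s)"
    by (rule sums_mult[OF assms])
  then have "(\<lambda>m. (case Suc m of 0 \<Rightarrow> 0 | Suc k \<Rightarrow> f k) * x ^ Suc m) sums (x * s)"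
    by (simp add: algebra_simps)
  then show ?thesis by (subst (asm) sums_Suc_iff) simp
qed

text \<open>
  All coefficients in the two raising relations are rational multiples of the same shifted
  coefficient, so each relation reduces to an identity between three rational functions of \<open>k\<close>.
\<close>

lemma gauss_coeff_Suc_common_factor:
  fixes a b c :: complex and k :: nat
  assumes c: "c \<notin> \<int>\<^sub>\<le>\<^sub>0"
  defines "V \<equiv> gauss_coeff (a + 1) (b + 1) (c + 2) k"
  shows "gauss_coeff a b c (Suc k) =
           V * (a * b * (c + 1 + of_nat k) / (c * (c + 1) * (1 + of_nat k)))"
    and "gauss_coeff a b (c + 1) (Suc k) = V * (a * b / ((c + 1) * (1 + of_nat k)))"
    and "gauss_coeff a (b + 1) (c + 1) (Suc k) =
           V * (a * (b + 1 + of_nat k) / ((c + 1) * (1 + of_nat k)))"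
proof -
  have nz: "c + 1 + of_nat k \<noteq> 0"
    using plus_nat_neq_0[OF c, of "Suc k"] by (simp add: add.assoc)
  have p: "pochhammer z (Suc k) = z * pochhammer (z + 1) k"
      "pochhammer (z + 1) (Suc k) = pochhammer (z + 1) k * (z + 1 + of_nat k)" for z :: complex
    by (simp add: pochhammer_rec, simp add: pochhammer_Suc)
  have q: "pochhammer (c + 1) (Suc k) = (c + 1) * pochhammer (c + 2) k"
    using pochhammer_rec[of "c + 1" k] by (simp add: add.assoc)
  have "pochhammer c (Suc k) * (c + 1 + of_nat k) = c * ((c + 1) * pochhammer (c + 2) k)"
    using p(1)[of c] p(2)[of c] q by simp
  then have r: "pochhammer c (Suc k) =
      c * ((c + 1) * pochhammer (c + 2) k) / (c + 1 + of_nat k)"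
    using nz by (simp add: eq_divide_eq)
  show "gauss_coeff a b c (Suc k) =
           V * (a * b * (c + 1 + of_nat k) / (c * (c + 1) * (1 + of_nat k)))"
    "gauss_coeff a b (c + 1) (Suc k) = V * (a * b / ((c + 1) * (1 + of_nat k)))"
    unfolding gauss_coeff_def V_def p(1)[of a] p(1)[of b] q r by (simp_all add: mult_ac)
  show "gauss_coeff a (b + 1) (c + 1) (Suc k) =
           V * (a * (b + 1 + of_nat k) / ((c + 1) * (1 + of_nat k)))"
    unfolding gauss_coeff_def V_def p(1)[of a] p(2)[of b] q by (simp add: mult_ac)
qed

lemma gauss_series_raise_c:
  assumes c: "c \<notin> \<int>\<^sub>\<le>\<^sub>0" and x: "norm x < 1"
  shows "gauss_series a b c x =
    gauss_series a b (c + 1) x + a * b / (c * (c + 1)) * (x * gauss_series (a + 1) (b + 1) (c + 2) x)"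
proof (rule sums_unique2[OF gauss_series_sums[OF x]])
  let ?g = "\<lambda>m. case m of 0 \<Rightarrow> 0 | Suc k \<Rightarrow> gauss_coeff (a + 1) (b + 1) (c + 2) k"
  have scale: "G * L = G * M + N * G" if "L = M + N" for G L M N :: complex
    unfolding that by (simp add: algebra_simps)
  have c0: "c \<noteq> 0" "c + 1 \<noteq> 0" using plus_nat_neq_0[OF c, of 0] plus_nat_neq_0[OF c, of 1] by auto
  have "gauss_coeff a b c m * x ^ m =
      gauss_coeff a b (c + 1) m * x ^ m + a * b / (c * (c + 1)) * (?g m * x ^ m)" for m
  proof (cases m)
    case 0
    then show ?thesis by (simp add: gauss_coeff_def)
  next
    case (Suc k)
    have "(1 + of_nat k :: complex) \<noteq> 0"
      by (metis of_nat_Suc of_nat_neq_0)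
    with c0 have "a * b * (c + 1 + of_nat k) / (c * (c + 1) * (1 + of_nat k)) =
        a * b / ((c + 1) * (1 + of_nat k)) + a * b / (c * (c + 1))"
      by (simp add: divide_simps) (simp add: algebra_simps)
    then have "gauss_coeff a b c (Suc k) = gauss_coeff a b (c + 1) (Suc k) +
        a * b / (c * (c + 1)) * gauss_coeff (a + 1) (b + 1) (c + 2) k"
      unfolding gauss_coeff_Suc_common_factor(1,2)[OF c, of a b k] by (rule scale)
    then show ?thesis by (simp add: Suc algebra_simps)
  qed
  then show "(\<lambda>m. gauss_coeff a b c m * x ^ m) sums (gauss_series a b (c + 1) x +
      a * b / (c * (c + 1)) * (x * gauss_series (a + 1) (b + 1) (c + 2) x))"
    by (simp only:) (intro sums_add sums_mult sums_times_x gauss_series_sums x)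
qed

lemma gauss_series_raise_b:
  assumes c: "c \<notin> \<int>\<^sub>\<le>\<^sub>0" and x: "norm x < 1"
  shows "gauss_series a b c x = gauss_series a (b + 1) (c + 1) x -
    a * (c - b) / (c * (c + 1)) * (x * gauss_series (a + 1) (b + 1) (c + 2) x)"
proof (rule sums_unique2[OF gauss_series_sums[OF x]])
  let ?g = "\<lambda>m. case m of 0 \<Rightarrow> 0 | Suc k \<Rightarrow> gauss_coeff (a + 1) (b + 1) (c + 2) k"
  have scale: "G * L = G * M - N * G" if "L = M - N" for G L M N :: complex
    unfolding that by (simp add: algebra_simps)
  have c0: "c \<noteq> 0" "c + 1 \<noteq> 0" using plus_nat_neq_0[OF c, of 0] plus_nat_neq_0[OF c, of 1] by auto
  have "gauss_coeff a b c m * x ^ m =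
      gauss_coeff a (b + 1) (c + 1) m * x ^ m - a * (c - b) / (c * (c + 1)) * (?g m * x ^ m)" for m
  proof (cases m)
    case 0
    then show ?thesis by (simp add: gauss_coeff_def)
  next
    case (Suc k)
    have "(1 + of_nat k :: complex) \<noteq> 0"
      by (metis of_nat_Suc of_nat_neq_0)
    with c0 have "a * b * (c + 1 + of_nat k) / (c * (c + 1) * (1 + of_nat k)) =
        a * (b + 1 + of_nat k) / ((c + 1) * (1 + of_nat k)) - a * (c - b) / (c * (c + 1))"
      by (simp add: divide_simps) (simp add: algebra_simps)
    then have "gauss_coeff a b c (Suc k) = gauss_coeff a (b + 1) (c + 1) (Suc k) -
        a * (c - b) / (c * (c + 1)) * gauss_coeff (a + 1) (b + 1) (c + 2) k"
      unfolding gauss_coeff_Suc_common_factor(1,3)[OF c, of a b k] by (rule scale)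
    then show ?thesis by (simp add: Suc left_diff_distrib mult.assoc)
  qed
  then show "(\<lambda>m. gauss_coeff a b c m * x ^ m) sums (gauss_series a (b + 1) (c + 1) x -
      a * (c - b) / (c * (c + 1)) * (x * gauss_series (a + 1) (b + 1) (c + 2) x))"
    by (simp only:) (intro sums_diff sums_mult sums_times_x gauss_series_sums x)
qed

text \<open>
  The three-term relation in \<open>a\<close>, solved for the smallest parameter. It gives access to the
  finitely many functions with \<^term>\<open>Re (a - c) < 0\<close>, for which the power in the Pfaff integrand is
  unbounded near the cut.
\<close>

lemma gauss_series_lower_a:
  assumes c: "c \<notin> \<int>\<^sub>\<le>\<^sub>0" and x: "norm x < 1"
  shows "(c - a - 1) * gauss_series a b c x = (c - 2 * a - 2) * gauss_series (a + 1) b c x +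
    (a + 1 - b) * (x * gauss_series (a + 1) b c x) + (a + 1) * gauss_series (a + 2) b c x
    - (a + 1) * (x * gauss_series (a + 2) b c x)"
proof (rule sums_unique2[OF sums_mult[OF gauss_series_sums[OF x]]])
  let ?g = "\<lambda>a m. case m of 0 \<Rightarrow> 0 | Suc k \<Rightarrow> gauss_coeff a b c k"
  have distrib: "p * (u * X) = q * (v * X) + r * (w * X) + s * (t * X) - s * (z * X)"
    if "p * u = q * v + r * w + s * t - s * z" for p q r s t u v w z X :: complex
  proof -
    have "p * (u * X) = (p * u) * X" by simp
    also note that
    finally show ?thesis by (simp add: algebra_simps)
  qed
  have "(c - a - 1) * (gauss_coeff a b c m * x ^ m) =
      (c - 2 * a - 2) * (gauss_coeff (a + 1) b c m * x ^ m) +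
      (a + 1 - b) * (?g (a + 1) m * x ^ m) + (a + 1) * (gauss_coeff (a + 2) b c m * x ^ m) -
      (a + 1) * (?g (a + 2) m * x ^ m)" for m
  proof (cases m)
    case 0
    then show ?thesis by (simp add: gauss_coeff_def algebra_simps)
  next
    case (Suc k)
    have nz: "pochhammer c k \<noteq> 0" "c + of_nat k \<noteq> 0"
      using pochhammer_not_nonpos_Int[OF c, of k] plus_nat_neq_0[OF c, of k] by auto
    have s: "(1 + of_nat k :: complex) \<noteq> 0"
      by (metis of_nat_Suc of_nat_neq_0)
    define A where "A = pochhammer (a + 1) k"
    have p1: "pochhammer a (Suc k) = a * A"
      by (simp add: pochhammer_rec A_def)
    have p2: "pochhammer (a + 1) (Suc k) = (a + 1 + of_nat k) * A"
      by (simp add: pochhammer_Suc A_def algebra_simps)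
    have "(a + 1) * pochhammer (a + 2) k = pochhammer (a + 1) (Suc k)"
      using pochhammer_rec[of "a + 1" k] by (simp add: add.assoc)
    then have p3: "(a + 1) * pochhammer (a + 2) k = (a + 1 + of_nat k) * A"
      using p2 by simp
    define V where "V = pochhammer b k / (pochhammer c k * fact k)"
    define R where "R = (b + of_nat k) / ((c + of_nat k) * (1 + of_nat k))"
    have V: "gauss_coeff a' b c (Suc k) = pochhammer a' (Suc k) * (V * R)"
      "gauss_coeff a' b c k = pochhammer a' k * V" for a'
      by (simp_all add: gauss_coeff_def V_def R_def pochhammer_Suc mult_ac)
    have "(c - a - 1) * a * R = (c - 2 * a - 2) * (a + 1 + of_nat k) * R
        + (a + 1 - b) + (a + 1 + of_nat k) * (a + 2 + of_nat k) * R - (a + 1 + of_nat k)"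
      using nz(2) s unfolding R_def by (simp add: divide_simps) (simp add: algebra_simps)
    then have "(c - a - 1) * (a * A) * (V * R) =
        (c - 2 * a - 2) * (((a + 1 + of_nat k) * A) * (V * R)) + (a + 1 - b) * (A * V)
        + ((a + 1 + of_nat k) * A * (a + 2 + of_nat k)) * (V * R) - ((a + 1 + of_nat k) * A) * V"
      by algebra
    then have "(c - a - 1) * gauss_coeff a b c (Suc k) =
      (c - 2 * a - 2) * gauss_coeff (a + 1) b c (Suc k) +
      (a + 1 - b) * gauss_coeff (a + 1) b c k + (a + 1) * gauss_coeff (a + 2) b c (Suc k) -
      (a + 1) * gauss_coeff (a + 2) b c k"
      unfolding V p1 p2 p3[symmetric] pochhammer_Suc[of "a + 2" k] A_def[symmetric]
      by (simp only: mult.assoc)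
    then show ?thesis unfolding Suc nat.case by (rule distrib)
  qed
  then show "(\<lambda>m. (c - a - 1) * (gauss_coeff a b c m * x ^ m)) sums (
    (c - 2 * a - 2) * gauss_series (a + 1) b c x +
    (a + 1 - b) * (x * gauss_series (a + 1) b c x) + (a + 1) * gauss_series (a + 2) b c x
    - (a + 1) * (x * gauss_series (a + 2) b c x))"
    by (simp only:) (intro sums_add sums_diff sums_mult sums_times_x gauss_series_sums x)
qed

section \<open>The Pfaff integral\<close>

text \<open>
  Gauss's product for the Gamma function and its reciprocal. Using \<^const>\<open>rGamma\<close> for \<open>a\<close> covers
  non-positive integers, where the left-hand side vanishes eventually.
\<close>

lemma pochhammer_ratio_tendsto:
  assumes c: "c \<notin> \<int>\<^sub>\<le>\<^sub>0"
  shows "(\<lambda>n. pochhammer a n / pochhammer c n * of_nat n powr (c - a)) \<longlonglongrightarrow> Gamma c * rGamma (a :: complex)"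
proof -
  have "(\<lambda>n. rGamma_series a n * Gamma_series c n * ((c + of_nat n) / (a + of_nat n))) \<longlonglongrightarrow>
      rGamma a * Gamma c * 1"
    by (intro tendsto_intros of_nat_shift_ratio_tendsto_1)
  moreover have "eventually (\<lambda>n. rGamma_series a n * Gamma_series c n * ((c + of_nat n) / (a + of_nat n)) =
      pochhammer a n / pochhammer c n * of_nat n powr (c - a)) sequentially"
  proof -
    obtain M :: nat where M: "real M > norm a" using reals_Archimedean2 by blast
    show ?thesis using eventually_ge_at_top[of "Suc M"]
    proof eventually_elim
      case (elim n)
      have "of_nat n \<noteq> - a"
      proof
        assume "of_nat n = - a"
        then have "real n = norm a" by (metis norm_minus_cancel norm_of_nat)
        with M elim show False by simp
      qed
      then have an: "a + of_nat n \<noteq> 0" by (metis add_eq_0_iff)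
      have cn: "c + of_nat n \<noteq> 0" by (rule plus_nat_neq_0[OF c])
      have p: "of_nat n powr (c - a) = exp (c * of_real (ln (of_nat n))) / exp (a * of_real (ln (of_nat n)))"
        using elim by (simp add: powr_def left_diff_distrib exp_diff flip: Ln_of_nat)
      have "rGamma_series a n * Gamma_series c n * ((c + of_nat n) / (a + of_nat n)) =
        (pochhammer a n * (a + of_nat n) / (fact n * exp (a * of_real (ln (of_nat n))))) *
        (fact n * exp (c * of_real (ln (of_nat n))) / (pochhammer c n * (c + of_nat n))) *
        ((c + of_nat n) / (a + of_nat n))"
        by (simp add: rGamma_series_def Gamma_series_def pochhammer_Suc)
      also have "\<dots> = pochhammer a n / pochhammer c n * of_nat n powr (c - a)"
        unfolding p using an cn by simp
      finally show ?case .
    qed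
  qed
  ultimately show ?thesis
    by (subst (asm) tendsto_cong) (auto simp: mult.commute)
qed

text \<open>
  The principal argument is at most \<open>\<pi>\<close>, so an imaginary part of the exponent costs a constant
  factor, independent of \<open>z\<close>. This gives uniformity up to the cut.
\<close>

lemma norm_powr_le:
  "norm ((z::complex) powr w) \<le> norm z powr Re w * exp (pi * \<bar>Im w\<bar>)"
proof (cases "z = 0")
  case False
  have "\<bar>Im w * Im (Ln z)\<bar> \<le> \<bar>Im w\<bar> * pi"
    unfolding abs_mult using mpi_less_Im_Ln[OF False] Im_Ln_le_pi[OF False]
    by (intro mult_left_mono) auto
  then have "Re w * ln (norm z) - Im w * Im (Ln z) \<le> Re w * ln (norm z) + pi * \<bar>Im w\<bar>"
    by (auto simp: abs_le_iff mult.commute)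
  then have "exp (Re w * ln (norm z) - Im w * Im (Ln z)) \<le> exp (Re w * ln (norm z) + pi * \<bar>Im w\<bar>)"
    by simp
  with False show ?thesis
    by (simp add: powr_def exp_add)
qed auto

definition beta_kernel :: "complex \<Rightarrow> complex \<Rightarrow> real \<Rightarrow> complex" where
  "beta_kernel b d s = of_real s powr (b - 1) * of_real (1 - s) powr (d - 1)"

definition segment_to :: "complex \<Rightarrow> real \<Rightarrow> complex" where
  "segment_to q s = 1 - of_real s + of_real s * q"

definition beta_int :: "complex \<Rightarrow> complex \<Rightarrow> complex" where
  "beta_int b d = integral {0..1} (beta_kernel b d)"

text \<open>
  The parameter \<open>q\<close> stands for \<^term>\<open>1 / (1 - x)\<close>, so that the limit \<open>x \<rightarrow> \<infinity>\<close> becomes the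
  behaviour at \<^term>\<open>q = 0\<close>, where the integral is a Beta integral.
\<close>

definition pfaff_int :: "complex \<Rightarrow> complex \<Rightarrow> complex \<Rightarrow> complex \<Rightarrow> complex" where
  "pfaff_int b d e q = integral {0..1} (\<lambda>s. beta_kernel b d s * segment_to q s powr e)"

lemma continuous_beta_kernel:
  assumes "Re b > 1" "Re d > 1"
  shows "continuous_on {0..1} (beta_kernel b d)"
  unfolding beta_kernel_def using assms by (intro continuous_intros) auto

text \<open>
  The slit plane is starlike with respect to 1.
\<close>

lemma segment_to_slit:
  assumes "q \<notin> \<real>\<^sub>\<le>\<^sub>0" "s \<in> {0..1}"
  shows "segment_to q s \<notin> \<real>\<^sub>\<le>\<^sub>0"
proof
  assume *: "segment_to q s \<in> \<real>\<^sub>\<le>\<^sub>0"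
  then have "s * Im q = 0" "1 - s + s * Re q \<le> 0"
    by (auto simp: segment_to_def complex_nonpos_Reals_iff)
  moreover have "s \<noteq> 0" using calculation by auto
  ultimately have "Im q = 0" "s * Re q \<le> 0" using assms by auto
  then have "Re q \<le> 0" using \<open>s \<noteq> 0\<close> assms by (auto simp: mult_le_0_iff)
  with \<open>Im q = 0\<close> assms show False by (auto simp: complex_nonpos_Reals_iff)
qed

text \<open>
  Only the modulus of \<open>q\<close> enters, not its argument: this is why the asymptotics of the Pfaff integral
  hold uniformly up to the cut.
\<close>

lemma norm_segment_to_le:
  assumes "norm q \<le> r" "s \<in> {0..1}"
  shows "norm (segment_to q s) \<le> 1 - s * (1 - r)"
proof -
  have "norm (segment_to q s) \<le> norm (complex_of_real (1 - s)) + norm (of_real s * q)"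
    unfolding segment_to_def by (rule order_trans[OF _ norm_triangle_ineq]) simp
  also have "norm (complex_of_real (1 - s)) = 1 - s"
    using assms by (subst norm_of_real) auto
  also have "norm (of_real s * q) \<le> s * r"
    using assms by (auto simp: norm_mult intro!: mult_left_mono)
  finally show ?thesis by (simp add: algebra_simps)
qed

lemma continuous_pfaff_integrand:
  assumes "Re b > 1" "Re d > 1" and "q \<notin> \<real>\<^sub>\<le>\<^sub>0 \<or> q = 0 \<and> Re e > 0"
  shows "continuous_on {0..1} (\<lambda>s. beta_kernel b d s * segment_to q s powr e)"
proof (intro continuous_intros continuous_beta_kernel assms)
  show "{0..1} \<subseteq> {s. 0 \<le> Re (segment_to q s) \<or> Im (segment_to q s) \<noteq> 0}"
    using assms(3) segment_to_slit[of q]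
    by (auto simp: complex_nonpos_Reals_iff) (auto simp: segment_to_def)
  show "0 < Re e" if "s \<in> {0..1}" "segment_to q s = 0" for s
    using assms(3) segment_to_slit[of q s] that by auto
  show "continuous_on {0..1} (segment_to q)"
    unfolding segment_to_def by (intro continuous_intros)
qed

text \<open>
  Differentiation under the integral sign is available on convex domains; the slit plane is not
  convex, so it is applied on small balls.
\<close>

lemma holomorphic_pfaff_int:
  assumes "Re b > 1" "Re d > 1"
  shows "pfaff_int b d e holomorphic_on - \<real>\<^sub>\<le>\<^sub>0"
proof -
  have "pfaff_int b d e field_differentiable at q" if q: "q \<notin> \<real>\<^sub>\<le>\<^sub>0" for q
  proof -
    have "open (- \<real>\<^sub>\<le>\<^sub>0 :: complex set)" by (simp add: open_Compl)
    then obtain r where r: "r > 0" "ball q r \<subseteq> - \<real>\<^sub>\<le>\<^sub>0"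
      using q by (meson ComplI open_contains_ball)
    let ?f' = "\<lambda>q s. beta_kernel b d s * (e * segment_to q s powr (e - 1) * of_real s)"
    have "(\<lambda>q. integral (cbox 0 1) (\<lambda>s. beta_kernel b d s * segment_to q s powr e))
        holomorphic_on ball q r"
    proof (rule leibniz_rule_holomorphic[where fx = ?f'])
      fix z s assume z: "z \<in> ball q r" and s: "s \<in> cbox 0 (1::real)"
      have "segment_to z s \<notin> \<real>\<^sub>\<le>\<^sub>0"
        using z s r by (intro segment_to_slit) auto
      moreover have "((\<lambda>z. segment_to z s) has_field_derivative of_real s) (at z within ball q r)"
        unfolding segment_to_def by (auto intro!: derivative_eq_intros)
      ultimately show "((\<lambda>z. beta_kernel b d s * segment_to z s powr e) has_field_derivative ?f' z s)
          (at z within ball q r)"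
        by (auto intro!: derivative_eq_intros simp: mult_ac)
    next
      fix z assume "z \<in> ball q r"
      then show "(\<lambda>s. beta_kernel b d s * segment_to z s powr e) integrable_on cbox 0 1"
        using r assms by (intro integrable_continuous) (auto simp: cbox_interval intro!: continuous_pfaff_integrand)
    next
      have *: "segment_to (fst p) (snd p) \<notin> \<real>\<^sub>\<le>\<^sub>0" if "p \<in> ball q r \<times> cbox 0 1" for p
        using that r by (intro segment_to_slit) auto
      show "continuous_on (ball q r \<times> cbox 0 1) (\<lambda>(z, s). ?f' z s)"
        unfolding case_prod_beta
      proof (intro continuous_intros)
        show "continuous_on (ball q r \<times> cbox 0 1) (\<lambda>p. beta_kernel b d (snd p))"
          using assms
          by (intro continuous_on_compose2[OF continuous_beta_kernel[of b d]] continuous_intros) auto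
        show "continuous_on (ball q r \<times> cbox 0 1) (\<lambda>p. segment_to (fst p) (snd p))"
          unfolding segment_to_def by (intro continuous_intros)
        show "ball q r \<times> cbox 0 1 \<subseteq>
            {z. 0 \<le> Re (segment_to (fst z) (snd z)) \<or> Im (segment_to (fst z) (snd z)) \<noteq> 0}"
          using * by (fastforce simp: complex_nonpos_Reals_iff)
        show "0 < Re (e - 1)" if "p \<in> ball q r \<times> cbox 0 1" "segment_to (fst p) (snd p) = 0" for p
          using *[OF that(1)] that(2) by auto
      qed
    qed auto
    then have "pfaff_int b d e holomorphic_on ball q r"
      by (simp add: pfaff_int_def[abs_def] cbox_interval)
    with r show ?thesis
      by (auto simp: holomorphic_on_open field_differentiable_def)
  qed
  then show ?thesis
    by (simp add: holomorphic_on_def field_differentiable_at_within)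
qed

lemma norm_pfaff_int_le:
  assumes "Re b > 1" "Re d > 1" "Re e \<ge> 0" "q \<notin> \<real>\<^sub>\<le>\<^sub>0" "norm q \<le> 1"
  shows "norm (pfaff_int b d e q) \<le> exp (pi * \<bar>Im e\<bar>)"
proof -
  have "norm (beta_kernel b d s * segment_to q s powr e) \<le> exp (pi * \<bar>Im e\<bar>)" if s: "s \<in> {0..1}" for s
  proof -
    have "norm (beta_kernel b d s) \<le> 1"
    proof -
      have "norm (complex_of_real t powr (z - 1)) \<le> 1" if "t \<in> {0..1}" "Re z > 1" for t z
        using that by (auto simp: norm_powr_real_powr powr_le1)
      from this[of s b] this[of "1 - s" d] show ?thesis
        using s assms unfolding beta_kernel_def norm_mult by (intro mult_le_one) auto
    qed
    moreover have "norm (segment_to q s powr e) \<le> exp (pi * \<bar>Im e\<bar>)"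
    proof -
      have "norm (segment_to q s) \<le> 1"
        using norm_segment_to_le[OF assms(5) s] by simp
      then have "norm (segment_to q s) powr Re e \<le> 1"
        using assms by (intro powr_le1) auto
      then show ?thesis
        using norm_powr_le[of "segment_to q s" e]
        by (smt (verit) mult_left_le_one_le exp_ge_zero powr_ge_zero)
    qed
    ultimately show ?thesis
      unfolding norm_mult by (metis mult_mono mult_1 norm_ge_zero zero_le_one)
  qed
  then have "norm (integral (cbox 0 1) (\<lambda>s. beta_kernel b d s * segment_to q s powr e)) \<le>
      exp (pi * \<bar>Im e\<bar>) * measure lborel (cbox 0 (1::real))"
    by (intro integrable_bound integrable_continuous)
       (use assms in \<open>auto simp: cbox_interval intro!: continuous_pfaff_integrand\<close>)
  then show ?thesis by (simp add: pfaff_int_def)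
qed

lemma tendsto_Ln_over: "((\<lambda>z. Ln (1 + z) / z) \<longlongrightarrow> 1) (at 0)"
proof -
  have "(Ln has_field_derivative inverse 1) (at 1)"
    by (rule has_field_derivative_Ln) (auto simp: complex_nonpos_Reals_iff)
  then show ?thesis by (simp add: DERIV_def)
qed

text \<open>
  The logarithm of the left-hand side is \<^term>\<open>(1 + e / of_nat n) * (- v) * (Ln (1 + z) / z)\<close> with
  \<^term>\<open>z = - v / of_nat n\<close>, and the last factor tends to the derivative of the logarithm at 1.
\<close>

lemma tendsto_powr_exp_limit:
  fixes v :: "nat \<Rightarrow> complex" and N :: "nat \<Rightarrow> nat"
  assumes N: "filterlim N at_top sequentially" and v: "v \<longlonglongrightarrow> u" and u: "u \<noteq> 0"
  shows "(\<lambda>k. (1 - v k / of_nat (N k)) powr (of_nat (N k) + e)) \<longlonglongrightarrow> exp (- u)"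
proof -
  define z where "z = (\<lambda>k. - v k / of_nat (N k))"
  have inv: "(\<lambda>k. 1 / of_nat (N k) :: complex) \<longlonglongrightarrow> 0"
    using filterlim_compose[OF lim_1_over_n N] .
  have z0: "z \<longlonglongrightarrow> 0"
    using tendsto_mult[OF tendsto_minus[OF v] inv] by (simp add: z_def)
  have Npos: "eventually (\<lambda>k. N k > 0) sequentially"
    by (rule eventually_compose_filterlim[OF eventually_gt_at_top N])
  have vnz: "eventually (\<lambda>k. v k \<noteq> 0) sequentially"
    using v u by (rule tendsto_imp_eventually_ne)
  have "eventually (\<lambda>k. z k \<noteq> 0) sequentially"
    using Npos vnz by eventually_elim (simp add: z_def)
  with z0 have "filterlim z (at 0) sequentially"
    by (simp add: filterlim_at)
  from filterlim_compose[OF tendsto_Ln_over this]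
  have L: "(\<lambda>k. Ln (1 + z k) / z k) \<longlonglongrightarrow> 1" .
  have "(\<lambda>k. exp ((1 + e * (1 / of_nat (N k))) * (- v k) * (Ln (1 + z k) / z k)))
      \<longlonglongrightarrow> exp ((1 + e * 0) * (- u) * 1)"
    by (intro tendsto_intros inv v L)
  moreover have "eventually (\<lambda>k. exp ((1 + e * (1 / of_nat (N k))) * (- v k) * (Ln (1 + z k) / z k)) =
      (1 - v k / of_nat (N k)) powr (of_nat (N k) + e)) sequentially"
  proof -
    have "eventually (\<lambda>k. norm (z k) < 1) sequentially"
      using tendsto_norm_zero[OF z0] by (rule order_tendstoD) simp
    with Npos vnz show ?thesis
    proof eventually_elim
      case (elim k)
      have "(1 + e * (1 / of_nat (N k))) * (- v k) * (Ln (1 + z k) / z k) =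
          (of_nat (N k) + e) * Ln (1 + z k)"
        using elim by (simp add: z_def field_simps)
      moreover have "1 + z k \<noteq> 0"
        using elim by (metis add_eq_0_iff norm_minus_cancel norm_one less_irrefl)
      ultimately show ?case by (simp add: powr_def z_def)
    qed
  qed
  ultimately show ?thesis by (auto simp: tendsto_cong)
qed

text \<open>
  For a large exponent \<open>n\<close> the integrand lives at distance \<open>1 / n\<close> from the origin. After the
  substitution \<^term>\<open>s = u / of_nat n\<close> it converges pointwise to the integrand of the Gamma integral, since
  \<^term>\<open>segment_to q s\<close> is \<^term>\<open>1 - u * (1 - q) / of_nat n\<close>; and it is dominated by a Gamma integrand with
  the weaker decay \<^term>\<open>exp (- (u::real) / 4)\<close> because \<^term>\<open>norm q \<le> 1 / 2\<close> and the real part of the exponent is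
  at least \<open>n / 2\<close>. The case \<^term>\<open>q k = 0\<close> is included for the evaluation of the Beta integral.
\<close>

lemma pfaff_int_dominated_limit:
  fixes N :: "nat \<Rightarrow> nat" and q :: "nat \<Rightarrow> complex"
  assumes bd: "Re b > 1" "Re d > 1"
    and N: "filterlim N at_top sequentially" and q: "q \<longlonglongrightarrow> 0"
    and q_slit: "\<And>k. q k \<notin> \<real>\<^sub>\<le>\<^sub>0 \<or> q k = 0" and q_half: "\<And>k. norm (q k) \<le> 1 / 2"
    and N_pos: "\<And>k. N k > 0" and N_half: "\<And>k. Re (of_nat (N k) + e) \<ge> real (N k) / 2"
  shows "(\<lambda>k. of_nat (N k) powr b * pfaff_int b d (of_nat (N k) + e) (q k)) \<longlonglongrightarrow> Gamma b"
proof -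
  \<comment> \<open>The integrand after the substitution, extended by 0 to the half-line. The factor N k powr b
    loses one power to the Jacobian.\<close>
  define f where "f = (\<lambda>k u. if u \<in> {0..real (N k)}
      then of_nat (N k) powr (b - 1) * (beta_kernel b d (u / N k) *
             segment_to (q k) (u / N k) powr (of_nat (N k) + e)) else 0)"
  \<comment> \<open>The rate 1 / 4: norm (segment_to (q k) s) is at most exp (- s / 2) with s = u / N k, and the
    real part of its exponent is at least N k / 2.\<close>
  define h where "h = (\<lambda>u. exp (pi * \<bar>Im e\<bar>) *
      norm (complex_of_real u powr (b - 1) / of_real (exp (1 / 4 * u))))"
  define g where "g = (\<lambda>u. complex_of_real u powr (b - 1) / of_real (exp u))"
  have f_int: "(f k has_integral of_nat (N k) powr b * pfaff_int b d (of_nat (N k) + e) (q k)) {0..}" for k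
  proof -
    have Np: "real (N k) > 0" "Re (of_nat (N k) + e) > 0"
      using N_pos[of k] N_half[of k] by (auto simp: field_simps)
    let ?F = "\<lambda>s. beta_kernel b d s * segment_to (q k) s powr (of_nat (N k) + e)"
    have "(?F has_integral pfaff_int b d (of_nat (N k) + e) (q k)) {0..1}"
      unfolding pfaff_int_def using bd q_slit[of k] Np(2)
      by (intro integrable_integral integrable_continuous_real continuous_pfaff_integrand) auto
    from has_integral_stretch_real[OF this, of "1 / real (N k)"]
    have "((\<lambda>u. ?F (u / N k)) has_integral of_nat (N k) * pfaff_int b d (of_nat (N k) + e) (q k))
        ((\<lambda>x. x * real (N k)) ` {0..1})"
      using Np by (simp add: scaleR_conv_of_real)
    also have "(\<lambda>x. x * real (N k)) ` {0..1} = {0..real (N k)}"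
      using image_mult_atLeastAtMost[of "real (N k)" 0 1] Np by (simp add: mult.commute)
    finally have "((\<lambda>u. of_nat (N k) powr (b - 1) * ?F (u / N k)) has_integral
        of_nat (N k) powr (b - 1) * (of_nat (N k) * pfaff_int b d (of_nat (N k) + e) (q k)))
        {0..real (N k)}"
      by (rule has_integral_mult_right)
    moreover have "of_nat (N k) powr (b - 1) * (of_nat (N k) * pfaff_int b d (of_nat (N k) + e) (q k))
        = of_nat (N k) powr b * pfaff_int b d (of_nat (N k) + e) (q k)"
      using N_pos[of k] by (simp add: powr_diff)
    moreover have "{0..real (N k)} \<subseteq> {0..}" by auto
    ultimately show ?thesis
      unfolding f_def by (subst has_integral_restrict) simp_all
  qed
  have h_int: "h integrable_on {0..}"
  proof -
    have "(\<lambda>u. complex_of_real u powr (b - 1) / of_real (exp (1 / 4 * u))) absolutely_integrable_on {0<..}"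
      using bd by (intro absolutely_integrable_Gamma_integral) auto
    then have "(\<lambda>u. norm (complex_of_real u powr (b - 1) / of_real (exp (1 / 4 * u)))) integrable_on {0<..}"
      by (simp only: absolutely_integrable_on_def)
    then have "h integrable_on {0<..}"
      unfolding h_def by (rule integrable_on_mult_right)
    then show ?thesis
    proof (rule integrable_spike_set)
      show "negligible {u \<in> {0<..} - {0..}. h u \<noteq> 0}"
        by (rule negligible_subset[of "{}"]) auto
      show "negligible {u \<in> {0..} - {0<..}. h u \<noteq> 0}"
        by (rule negligible_subset[of "{0}"]) auto
    qed
  qed
  have f_le: "norm (f k u) \<le> h u" if u: "u \<in> {0..}" for k u
  proof (cases "u \<in> {0..real (N k)} \<and> u > 0")
    case False
    then have "f k u = 0"
      using u by (auto simp: f_def beta_kernel_def)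
    then show ?thesis by (simp add: h_def)
  next
    case True
    define s where "s = u / real (N k)"
    have s: "s \<in> {0..1}" "s > 0" and us: "u = real (N k) * s"
      using True N_pos[of k] by (auto simp: s_def)
    have a1: "of_nat (N k) powr (b - 1) * complex_of_real s powr (b - 1) = of_real u powr (b - 1)"
      unfolding us using s by (subst powr_times_real[symmetric]) (auto simp: of_real_mult)
    have a2: "norm (complex_of_real (1 - s) powr (d - 1)) \<le> 1"
      using s bd by (auto simp: norm_powr_real_powr powr_le1)
    have a3: "norm (segment_to (q k) s powr (of_nat (N k) + e)) \<le> exp (- u / 4) * exp (pi * \<bar>Im e\<bar>)"
    proof -
      have "norm (segment_to (q k) s) \<le> 1 - s * (1 - 1 / 2)"
        by (rule norm_segment_to_le[OF q_half s(1)])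
      also have "\<dots> \<le> exp (- s / 2)"
        using exp_ge_add_one_self[of "- s / 2"] by simp
      finally have "norm (segment_to (q k) s) powr Re (of_nat (N k) + e)
          \<le> exp (- s / 2) powr Re (of_nat (N k) + e)"
        using N_half[of k] by (intro powr_mono2) auto
      also have "\<dots> = exp (- s / 2 * Re (of_nat (N k) + e))"
        by (simp add: powr_def mult.commute)
      also have "\<dots> \<le> exp (- s / 2 * (real (N k) / 2))"
        using N_half[of k] s by (intro exp_le_cancel_iff[THEN iffD2] mult_left_mono_neg) auto
      also have "- s / 2 * (real (N k) / 2) = - u / 4"
        by (simp add: us)
      finally have "norm (segment_to (q k) s) powr Re (of_nat (N k) + e) \<le> exp (- u / 4)" .
      then have upper: "norm (segment_to (q k) s) powr Re (of_nat (N k) + e) * exp (pi * \<bar>Im e\<bar>) \<le>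
          exp (- u / 4) * exp (pi * \<bar>Im e\<bar>)"
        by (rule mult_right_mono) simp
      have "norm (segment_to (q k) s powr (of_nat (N k) + e)) \<le>
          norm (segment_to (q k) s) powr Re (of_nat (N k) + e) * exp (pi * \<bar>Im e\<bar>)"
        using norm_powr_le[of "segment_to (q k) s" "of_nat (N k) + e"] by simp
      then show ?thesis by (rule order_trans[OF _ upper])
    qed
    have "f k u = (of_nat (N k) powr (b - 1) * complex_of_real s powr (b - 1)) *
        complex_of_real (1 - s) powr (d - 1) * segment_to (q k) s powr (of_nat (N k) + e)"
      using True by (simp add: f_def beta_kernel_def s_def)
    then have "norm (f k u) = norm (complex_of_real u powr (b - 1)) *
        norm (complex_of_real (1 - s) powr (d - 1)) * norm (segment_to (q k) s powr (of_nat (N k) + e))"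
      unfolding a1 by (simp add: norm_mult)
    also have "\<dots> \<le> norm (complex_of_real u powr (b - 1)) * 1 * (exp (- u / 4) * exp (pi * \<bar>Im e\<bar>))"
      by (intro mult_mono a2 a3) auto
    also have "\<dots> = h u"
      by (simp add: h_def norm_divide exp_minus field_simps)
    finally show ?thesis .
  qed
  have f_lim: "(\<lambda>k. f k u) \<longlonglongrightarrow> g u" if u: "u \<in> {0..}" for u
  proof (cases "u = 0")
    case True
    then show ?thesis by (simp add: f_def g_def beta_kernel_def)
  next
    case False
    with u have u0: "u > 0" by auto
    have inv: "(\<lambda>k. 1 / real (N k)) \<longlonglongrightarrow> 0"
      using filterlim_compose[OF lim_1_over_n N] .
    have v: "(\<lambda>k. of_real u * (1 - q k)) \<longlonglongrightarrow> of_real u * (1 - 0)"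
      by (intro tendsto_intros q)
    have l1: "(\<lambda>k. (1 - (of_real u * (1 - q k)) / of_nat (N k)) powr (of_nat (N k) + e))
        \<longlonglongrightarrow> exp (- (of_real u * (1 - 0)))"
      using u0 by (intro tendsto_powr_exp_limit N v) auto
    have "(\<lambda>k. complex_of_real (1 - u * (1 / real (N k))) powr (d - 1)) \<longlonglongrightarrow> of_real (1 - u * 0) powr (d - 1)"
      by (intro tendsto_intros inv) (auto simp: complex_nonpos_Reals_iff)
    then have l2: "(\<lambda>k. of_real u powr (b - 1) * complex_of_real (1 - u * (1 / real (N k))) powr (d - 1) *
        (1 - (of_real u * (1 - q k)) / of_nat (N k)) powr (of_nat (N k) + e)) \<longlonglongrightarrow>
        of_real u powr (b - 1) * of_real (1 - u * 0) powr (d - 1) * exp (- (of_real u * (1 - 0)))"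
      by (intro tendsto_mult tendsto_const l1)
    have "eventually (\<lambda>k. real (N k) > u) sequentially"
      using filterlim_compose[OF filterlim_real_sequentially N] by (auto simp: filterlim_at_top_dense)
    then have "eventually (\<lambda>k. of_real u powr (b - 1) * complex_of_real (1 - u * (1 / real (N k))) powr (d - 1) *
        (1 - (of_real u * (1 - q k)) / of_nat (N k)) powr (of_nat (N k) + e) = f k u) sequentially"
    proof eventually_elim
      case (elim k)
      define s where "s = u / real (N k)"
      have s: "s \<ge> 0" and us: "u = real (N k) * s"
        using u0 N_pos[of k] by (auto simp: s_def)
      have a1: "of_real u powr (b - 1) = of_nat (N k) powr (b - 1) * complex_of_real s powr (b - 1)"
        unfolding us using s by (subst powr_times_real[symmetric]) (auto simp: of_real_mult)
      have a2: "1 - (of_real u * (1 - q k)) / of_nat (N k) = segment_to (q k) s"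
        using N_pos[of k] by (simp add: segment_to_def s_def field_simps)
      show ?case
        unfolding a1 a2 using elim u0 by (simp add: f_def beta_kernel_def s_def)
    qed
    with l2 have "(\<lambda>k. f k u) \<longlonglongrightarrow>
        of_real u powr (b - 1) * of_real (1 - u * 0) powr (d - 1) * exp (- (of_real u * (1 - 0)))"
      by (rule Lim_transform_eventually)
    then show ?thesis
      by (simp add: g_def exp_minus divide_inverse flip: exp_of_real)
  qed
  have "(\<lambda>k. integral {0..} (f k)) \<longlonglongrightarrow> integral {0..} g"
    by (rule dominated_convergence(2)[OF _ h_int f_le f_lim]) (use f_int in \<open>auto simp: integrable_on_def\<close>)
  moreover have "integral {0..} g = Gamma b"
    unfolding g_def using bd by (intro integral_unique Gamma_integral_complex) auto
  moreover have "integral {0..} (f k) = of_nat (N k) powr b * pfaff_int b d (of_nat (N k) + e) (q k)" for k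
    using f_int by (rule integral_unique)
  ultimately show ?thesis by simp
qed

section \<open>Existence of the continuation of the Gauss series\<close>

lemma Re_gt_1_not_nonpos_Int: "Re z > 1 \<Longrightarrow> z \<notin> \<int>\<^sub>\<le>\<^sub>0"
  by (auto elim!: nonpos_Ints_cases')

lemma powr_eq_times_powr: "(z::complex) powr w = z * z powr (w - 1)"
  by (cases "z = 0") (auto simp: powr_diff)

text \<open>
  Integrating the derivative of \<^term>\<open>z powr b * (1 - z) powr d\<close> over the unit interval gives 0.
\<close>

lemma beta_int_plus_1:
  assumes bd: "Re b > 1" "Re d > 1"
  shows "(b + d) * beta_int b (d + 1) = d * beta_int b d"
proof -
  let ?F = "\<lambda>z::complex. z powr b * (1 - z) powr d"
  let ?F' = "\<lambda>s. (b + d) * beta_kernel b (d + 1) s - d * beta_kernel b d s"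
  have "(?F' has_integral ?F (of_real 1) - ?F (of_real 0)) {0..1}"
  proof (rule fundamental_theorem_of_calculus_interior)
    show "continuous_on {0..1} (\<lambda>s. ?F (of_real s))"
      using bd by (intro continuous_intros) auto
    fix s :: real assume s: "s \<in> {0<..<1}"
    have "1 - complex_of_real s = of_real (1 - s)" by simp
    with s have n: "complex_of_real s \<notin> \<real>\<^sub>\<le>\<^sub>0" "1 - complex_of_real s \<notin> \<real>\<^sub>\<le>\<^sub>0"
      by (auto simp: complex_nonpos_Reals_iff)
    have "(?F has_field_derivative
        b * of_real s powr (b - 1) * (1 - of_real s) powr d -
        d * of_real s powr b * (1 - of_real s) powr (d - 1)) (at (of_real s))"
      using n by (auto intro!: derivative_eq_intros simp: mult_ac)
    moreover have "b * of_real s powr (b - 1) * (1 - of_real s) powr d -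
        d * of_real s powr b * (1 - of_real s) powr (d - 1) = ?F' s"
      unfolding beta_kernel_def powr_eq_times_powr[of "of_real s" b]
        powr_eq_times_powr[of "1 - of_real s" d] by (simp add: powr_eq_times_powr[of "1 - of_real s" d] algebra_simps)
    ultimately show "((\<lambda>s. ?F (of_real s)) has_vector_derivative ?F' s) (at s)"
      using has_vector_derivative_real_field[of ?F "?F' s" s UNIV] by simp
  qed simp
  then have "(?F' has_integral 0) {0..1}" using bd by simp
  moreover have "(?F' has_integral ((b + d) * beta_int b (d + 1) - d * beta_int b d)) {0..1}"
    unfolding beta_int_def using bd
    by (intro has_integral_diff has_integral_mult_right integrable_integral
          integrable_continuous_real continuous_beta_kernel) auto
  ultimately have "(b + d) * beta_int b (d + 1) - d * beta_int b d = 0"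
    by (rule has_integral_unique[THEN sym])
  then show ?thesis by simp
qed

lemma beta_int_plus_nat_right:
  assumes bd: "Re b > 1" "Re d > 1"
  shows "beta_int b (d + of_nat n) = pochhammer d n / pochhammer (b + d) n * beta_int b d"
proof (induction n)
  case (Suc n)
  have "b + d + of_nat n \<noteq> 0"
    by (rule plus_nat_neq_0, rule Re_gt_1_not_nonpos_Int) (use bd in auto)
  moreover have "(b + d + of_nat n) * beta_int b (d + of_nat (Suc n)) =
      (d + of_nat n) * beta_int b (d + of_nat n)"
    using beta_int_plus_1[of b "d + of_nat n"] bd by (simp add: add_ac)
  ultimately have "beta_int b (d + of_nat (Suc n)) =
      (d + of_nat n) * beta_int b (d + of_nat n) / (b + d + of_nat n)"
    by (metis nonzero_mult_div_cancel_left)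
  then show ?case
    unfolding Suc.IH pochhammer_Suc by simp
qed auto

lemma pfaff_int_0:
  "pfaff_int b d (of_nat n) 0 = beta_int b (d + of_nat n)"
proof -
  have "beta_kernel b d s * segment_to 0 s powr of_nat n = beta_kernel b (d + of_nat n) s" for s
    using powr_add[of "1 - complex_of_real s" "d - 1" "of_nat n"]
    by (simp add: beta_kernel_def segment_to_def algebra_simps)
  then show ?thesis by (simp add: pfaff_int_def beta_int_def)
qed

text \<open>
  Euler's formula for complex parameters. By the recursion in \<open>d\<close> the Beta integral is determined by
  its behaviour as \<open>d \<rightarrow> \<infinity>\<close>, which is the case \<^term>\<open>q = 0\<close> of \<open>pfaff_int_dominated_limit\<close>.
\<close>

lemma beta_int_eq:
  assumes bd: "Re b > 1" "Re d > 1"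
  shows "beta_int b d = Gamma b * Gamma d / Gamma (b + d)"
proof -
  have np: "b + d \<notin> \<int>\<^sub>\<le>\<^sub>0" "d \<notin> \<int>\<^sub>\<le>\<^sub>0"
    using bd by (auto intro!: Re_gt_1_not_nonpos_Int)
  have "(\<lambda>n. pochhammer d n / pochhammer (b + d) n * of_nat n powr (b + d - d) * beta_int b d)
      \<longlonglongrightarrow> Gamma (b + d) * rGamma d * beta_int b d"
    by (intro tendsto_mult tendsto_const pochhammer_ratio_tendsto np)
  then have "(\<lambda>n. of_nat n powr b * beta_int b (d + of_nat n))
      \<longlonglongrightarrow> Gamma (b + d) * rGamma d * beta_int b d"
    unfolding beta_int_plus_nat_right[OF bd] by (simp add: mult_ac)
  then have l1: "(\<lambda>n. of_nat (Suc n) powr b * beta_int b (d + of_nat (Suc n)))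
      \<longlonglongrightarrow> Gamma (b + d) * rGamma d * beta_int b d"
    by (rule LIMSEQ_Suc)
  \<comment> \<open>The indices start at 1, as the dominated limit asks for positive exponents.\<close>
  have "(\<lambda>n. of_nat (Suc n) powr b * pfaff_int b d (of_nat (Suc n) + 0) 0) \<longlonglongrightarrow> Gamma b"
    by (rule pfaff_int_dominated_limit[OF bd filterlim_Suc]) auto
  then have "(\<lambda>n. of_nat (Suc n) powr b * beta_int b (d + of_nat (Suc n))) \<longlonglongrightarrow> Gamma b"
    unfolding add_0_right pfaff_int_0 .
  from LIMSEQ_unique[OF l1 this] show ?thesis
    using np by (simp add: rGamma_inverse_Gamma Gamma_eq_zero_iff field_simps)
qed

lemma beta_int_plus_nat_left:
  assumes bd: "Re b > 1" "Re d > 1"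
  shows "beta_int (b + of_nat m) d = pochhammer b m / pochhammer (b + d) m * beta_int b d"
proof -
  have np: "b \<notin> \<int>\<^sub>\<le>\<^sub>0" "b + d \<notin> \<int>\<^sub>\<le>\<^sub>0" "b + of_nat m \<notin> \<int>\<^sub>\<le>\<^sub>0" "b + d + of_nat m \<notin> \<int>\<^sub>\<le>\<^sub>0"
    using bd by (auto intro!: Re_gt_1_not_nonpos_Int)
  show ?thesis
    using bd np by (subst (1 2) beta_int_eq)
      (auto simp: pochhammer_Gamma Gamma_eq_zero_iff add_ac)
qed

lemma beta_int_neq_0: "Re b > 1 \<Longrightarrow> Re d > 1 \<Longrightarrow> beta_int b d \<noteq> 0"
  using Re_gt_1_not_nonpos_Int[of b] Re_gt_1_not_nonpos_Int[of d] Re_gt_1_not_nonpos_Int[of "b + d"]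
  by (subst beta_int_eq) (auto simp: Gamma_eq_zero_iff)

lemma binomial_series_sums:
  fixes z :: complex
  assumes "norm z < 1"
  shows "(\<lambda>m. pochhammer a m / fact m * z ^ m) sums (1 - z) powr (- a)"
proof -
  have "(- a gchoose m) * (- z) ^ m = pochhammer a m / fact m * z ^ m" for m
  proof -
    have "(- 1) ^ m * (- 1) ^ m = (1 :: complex)"
      by (simp flip: power_mult_distrib)
    then show ?thesis
      unfolding gbinomial_pochhammer power_minus[of z m] minus_minus by (simp add: field_simps)
  qed
  then show ?thesis
    using gen_binomial_complex[of "- z" "- a"] assms by simp
qed

text \<open>
  Euler's integral: expand the last factor by the binomial series, which converges uniformly on the
  interval, and integrate term by term. Real arguments suffice because the result is only used
  through the identity theorem.
\<close>

lemma euler_int_eq_gauss_series: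
  fixes x :: real
  assumes bd: "Re b > 1" "Re d > 1" and x: "0 < x" "x < 1"
  shows "integral {0..1} (\<lambda>t. beta_kernel b d t * (1 - of_real (x * t)) powr (- a)) =
           beta_int b d * gauss_series a b (b + d) (of_real x)"
proof -
  let ?f = "\<lambda>m t. beta_kernel b d t * (pochhammer a m / fact m * of_real (x * t) ^ m)"
  have "bounded (beta_kernel b d ` {0..1})"
    by (intro compact_imp_bounded compact_continuous_image continuous_beta_kernel bd) auto
  then obtain B where "\<forall>y\<in>beta_kernel b d ` {0..1}. norm y \<le> B"
    by (auto simp: bounded_iff)
  then have B: "norm (beta_kernel b d t) \<le> B" if "t \<in> {0..1}" for t
    using that by blast
  obtain r where r: "x < r" "r < 1" using dense[OF x(2)] by blast
  have "summable (\<lambda>m. pochhammer a m / fact m * complex_of_real r ^ m)"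
    using binomial_series_sums[of "of_real r" a] r x by (auto simp: sums_iff)
  then have "summable (\<lambda>m. norm (pochhammer a m / fact m * complex_of_real x ^ m))"
    by (rule powser_insidea) (use r x in auto)
  then have M: "summable (\<lambda>m. B * norm (pochhammer a m / fact m * complex_of_real x ^ m))"
    by (rule summable_mult)
  have "uniform_limit {0..1} (\<lambda>n t. \<Sum>m<n. ?f m t) (\<lambda>t. \<Sum>m. ?f m t) sequentially"
  proof (rule Weierstrass_m_test[OF _ M])
    fix m and t :: real assume t: "t \<in> {0..1}"
    have "norm (complex_of_real (x * t) ^ m) \<le> norm (complex_of_real x ^ m)"
      unfolding norm_power using t x by (intro power_mono) (auto simp: norm_mult mult_left_le)
    then show "norm (?f m t) \<le> B * norm (pochhammer a m / fact m * complex_of_real x ^ m)"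
      unfolding norm_mult using B[OF t] by (intro mult_mono mult_nonneg_nonneg order_trans[OF _ B[OF t]]) auto
  qed
  moreover have "(\<Sum>m. ?f m t) = beta_kernel b d t * (1 - of_real (x * t)) powr (- a)" if "t \<in> {0..1}" for t
  proof -
    have "\<bar>x * t\<bar> < 1"
      using that x by (auto simp: abs_mult intro: le_less_trans[OF mult_left_le])
    then show ?thesis
      by (intro sums_unique[symmetric] sums_mult binomial_series_sums) (simp add: norm_of_real del: of_real_mult)
  qed
  ultimately have "uniform_limit {0..1} (\<lambda>n t. \<Sum>m<n. ?f m t)
      (\<lambda>t. beta_kernel b d t * (1 - of_real (x * t)) powr (- a)) sequentially"
    by (subst (asm) uniform_limit_cong'[OF refl]) auto
  then obtain I J where I: "\<And>n. ((\<lambda>t. \<Sum>m<n. ?f m t) has_integral I n) {0..1}"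
    and J: "((\<lambda>t. beta_kernel b d t * (1 - of_real (x * t)) powr (- a)) has_integral J) {0..1}"
    and IJ: "I \<longlonglongrightarrow> J"
    by (rule uniform_limit_integral)
       (auto intro!: continuous_intros continuous_beta_kernel bd)
  have term_int: "(?f m has_integral beta_int b d * (gauss_coeff a b (b + d) m * of_real x ^ m)) {0..1}" for m
  proof -
    have kernel: "beta_kernel b d t * of_real t ^ m = beta_kernel (b + of_nat m) d t" if "t \<in> {0..1}" for t
    proof (cases "t = 0")
      case False
      then have "complex_of_real t powr (b + of_nat m - 1) = of_real t powr (b - 1) * of_real t ^ m"
        using powr_add[of "complex_of_real t" "b - 1" "of_nat m"]
        by (simp add: powr_nat' algebra_simps)
      then show ?thesis by (simp add: beta_kernel_def mult_ac)
    qed (auto simp: beta_kernel_def)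
    have "((\<lambda>t. (pochhammer a m / fact m * of_real x ^ m) * beta_kernel (b + of_nat m) d t) has_integral
        (pochhammer a m / fact m * of_real x ^ m) * beta_int (b + of_nat m) d) {0..1}"
      unfolding beta_int_def using bd
      by (intro has_integral_mult_right integrable_integral integrable_continuous_real
            continuous_beta_kernel) auto
    moreover have "(pochhammer a m / fact m * of_real x ^ m) * beta_int (b + of_nat m) d =
        beta_int b d * (gauss_coeff a b (b + d) m * of_real x ^ m)"
      by (simp add: beta_int_plus_nat_left[OF bd] gauss_coeff_def mult_ac)
    ultimately have "((\<lambda>t. (pochhammer a m / fact m * of_real x ^ m) * beta_kernel (b + of_nat m) d t)
        has_integral beta_int b d * (gauss_coeff a b (b + d) m * of_real x ^ m)) {0..1}"
      by simp
    then show ?thesis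
      by (rule has_integral_eq[rotated]) (simp add: power_mult_distrib flip: kernel)
  qed
  have I_eq: "I n = (\<Sum>m<n. beta_int b d * (gauss_coeff a b (b + d) m * of_real x ^ m))" for n
    by (rule has_integral_unique[OF I]) (intro has_integral_sum term_int finite_lessThan)
  have "(\<lambda>m. beta_int b d * (gauss_coeff a b (b + d) m * of_real x ^ m)) sums J"
    using IJ unfolding sums_def I_eq .
  moreover have "(\<lambda>m. beta_int b d * (gauss_coeff a b (b + d) m * of_real x ^ m)) sums
      (beta_int b d * gauss_series a b (b + d) (of_real x))"
    using x by (intro sums_mult gauss_series_sums) auto
  ultimately have "J = beta_int b d * gauss_series a b (b + d) (of_real x)"
    by (rule sums_unique2)
  with J show ?thesis by (simp add: integral_unique)
qed

lemma of_real_powr_eq_exp: "r > 0 \<Longrightarrow> complex_of_real r powr z = exp (z * of_real (ln r))"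
  by (simp add: powr_def Ln_of_real)

text \<open>
  The real substitution \<^term>\<open>t = s / (w * (1 - s) + s)\<close> with \<^term>\<open>w = 1 - x\<close> turns Euler's integral,
  whose integrand is singular at \<^term>\<open>t = 1 / x\<close> close to the cut, into Pfaff's form. For complex \<open>x\<close>
  this would be a change of contour; for real \<open>x\<close> it is an ordinary change of variables.
\<close>

lemma pfaff_int_eq_euler_int:
  fixes x :: real
  assumes bd: "Re b > 1" "Re d > 1" and x: "0 < x" "x < 1"
  shows "of_real (1 - x) powr (- b) * pfaff_int b d (a - (b + d)) (1 / of_real (1 - x)) =
    integral {0..1} (\<lambda>t. beta_kernel b d t * (1 - of_real (x * t)) powr (- a))"
proof -
  define w where "w = 1 - x"
  have w: "0 < w" "w < 1" using x by (auto simp: w_def)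
  define D where "D = (\<lambda>s. w * (1 - s) + s)"
  define g where "g = (\<lambda>s. s / D s)"
  let ?f = "\<lambda>t. beta_kernel b d t * (1 - of_real (x * t)) powr (- a)"
  have D_pos: "D s > 0" if "s \<in> {0..1}" for s
    using that w by (cases "s = 0") (auto simp: D_def intro!: add_nonneg_pos)
  have g1: "1 - g s = w * (1 - s) / D s" and g2: "1 - x * g s = w / D s" if "s \<in> {0..1}" for s
    using D_pos[OF that] by (auto simp: g_def D_def w_def field_simps)
  have "((\<lambda>s. (w / D s ^ 2) *\<^sub>R ?f (g s)) has_integral integral {g 0..g 1} ?f) {0..1}"
  proof (rule has_integral_substitution[where c = 0 and d = 1])
    show "g ` {0..1} \<subseteq> {0..1}"
    proof safe
      fix s :: real assume s: "s \<in> {0..1}"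
      have "1 - g s \<ge> 0" unfolding g1[OF s] using s w D_pos[OF s] by auto
      moreover have "g s \<ge> 0" unfolding g_def using s w D_pos[OF s] by auto
      ultimately show "g s \<in> {0..1}" by auto
    qed
    show "continuous_on {0..1} ?f"
    proof (intro continuous_intros continuous_beta_kernel bd)
      have "Re (1 - complex_of_real (x * t)) > 0" if "t \<in> {0..1}" for t
        using that x by (auto intro: le_less_trans[OF mult_left_le])
      then show "{0..1} \<subseteq> {t. 0 \<le> Re (1 - complex_of_real (x * t)) \<or> Im (1 - complex_of_real (x * t)) \<noteq> 0}"
        and "\<And>t. t \<in> {0..1} \<Longrightarrow> 1 - complex_of_real (x * t) = 0 \<Longrightarrow> 0 < Re (- a)"
        by (force intro: less_imp_le, metis less_irrefl zero_complex.sel(1))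
    qed
    fix s :: real assume s: "s \<in> {0..1}"
    show "(g has_field_derivative w / D s ^ 2) (at s within {0..1})"
      unfolding g_def using D_pos[OF s]
      by (auto intro!: derivative_eq_intros simp: D_def power2_eq_square algebra_simps)
  qed (auto simp: g_def D_def w_def x)
  moreover have "g 0 = 0" "g 1 = 1" by (auto simp: g_def D_def)
  ultimately have sub: "((\<lambda>s. (w / D s ^ 2) *\<^sub>R ?f (g s)) has_integral integral {0..1} ?f) {0..1}"
    by simp
  \<comment> \<open>At the end points both sides vanish; in between all bases are positive reals, and it remains
    to compare the coefficients of ln s, ln (1 - s), ln w and ln (D s).\<close>
  have integrand: "(w / D s ^ 2) *\<^sub>R ?f (g s) =
      of_real w powr (- b) * (beta_kernel b d s * segment_to (1 / of_real w) s powr (a - (b + d)))"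
    if s: "s \<in> {0..1}" for s
  proof (cases "s = 0 \<or> s = 1")
    case True
    then show ?thesis by (auto simp: g_def D_def beta_kernel_def)
  next
    case False
    with s have s': "0 < s" "s < 1" by auto
    note Dp = D_pos[OF s]
    have e1: "ln (g s) = ln s - ln (D s)" unfolding g_def using s' Dp by (simp add: ln_div)
    have e2: "ln (1 - g s) = ln w + ln (1 - s) - ln (D s)"
      unfolding g1[OF s] using s' w Dp by (simp add: ln_div ln_mult)
    have e3: "ln (1 - x * g s) = ln w - ln (D s)"
      unfolding g2[OF s] using w Dp by (simp add: ln_div)
    have e4: "complex_of_real (w / D s ^ 2) = exp (of_real (ln w - 2 * ln (D s)))"
      using w Dp by (subst exp_of_real) (simp add: exp_diff exp_double)
    have seg: "segment_to (1 / of_real w) s = of_real (D s / w)"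
      using w by (simp add: segment_to_def D_def field_simps)
    have e5: "ln (D s / w) = ln (D s) - ln w" using w Dp by (simp add: ln_div)
    have pos: "g s > 0" "1 - g s > 0" "1 - x * g s > 0" "D s / w > 0"
      unfolding g1[OF s] g2[OF s] using s' w Dp by (auto simp: g_def)
    have "(w / D s ^ 2) *\<^sub>R ?f (g s) = of_real (w / D s ^ 2) *
        (of_real (g s) powr (b - 1) * of_real (1 - g s) powr (d - 1) * of_real (1 - x * g s) powr (- a))"
      by (simp add: scaleR_conv_of_real beta_kernel_def)
    also have "\<dots> = exp (of_real (ln w - 2 * ln (D s)) + (b - 1) * of_real (ln (g s)) +
        (d - 1) * of_real (ln (1 - g s)) + (- a) * of_real (ln (1 - x * g s)))"
      unfolding e4 of_real_powr_eq_exp[OF pos(1)] of_real_powr_eq_exp[OF pos(2)]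
        of_real_powr_eq_exp[OF pos(3)] by (simp only: exp_add mult_ac)
    also have "of_real (ln w - 2 * ln (D s)) + (b - 1) * of_real (ln (g s)) +
        (d - 1) * of_real (ln (1 - g s)) + (- a) * of_real (ln (1 - x * g s)) =
        (- b) * of_real (ln w) + (b - 1) * of_real (ln s) + (d - 1) * of_real (ln (1 - s)) +
        (a - (b + d)) * of_real (ln (D s / w))"
      unfolding e1 e2 e3 e5 by (simp add: algebra_simps)
    also have "exp \<dots> = of_real w powr (- b) * (of_real s powr (b - 1) * of_real (1 - s) powr (d - 1) *
        of_real (D s / w) powr (a - (b + d)))"
      unfolding of_real_powr_eq_exp[OF pos(4)] using s' w
      by (simp only: of_real_powr_eq_exp exp_add mult_ac diff_gt_0_iff_gt)
    finally show ?thesis by (simp only: beta_kernel_def seg)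
  qed
  have "((\<lambda>s. of_real w powr (- b) * (beta_kernel b d s * segment_to (1 / of_real w) s powr (a - (b + d))))
      has_integral integral {0..1} ?f) {0..1}"
    by (rule has_integral_eq[OF integrand sub])
  from integral_unique[OF this] show ?thesis
    by (simp add: pfaff_int_def w_def)
qed

lemma inverse_1_minus_slit: "x \<in> cut_plane \<Longrightarrow> 1 / (1 - x) \<notin> \<real>\<^sub>\<le>\<^sub>0"
  by (simp add: cut_plane_iff divide_inverse)

text \<open>
  The right-hand side is holomorphic on the cut plane and agrees with the series on the real segment
  from 0 to 1, whose points accumulate at 0.
\<close>

lemma continues_gauss_series_pfaff:
  assumes bd: "Re b > 1" "Re (c - b) > 1"
  shows "continues_gauss_series a b c
    (\<lambda>x. (1 - x) powr (- b) * pfaff_int b (c - b) (a - c) (1 / (1 - x)) / beta_int b (c - b))"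
    (is "continues_gauss_series a b c ?F")
  unfolding continues_gauss_series_def
proof (intro conjI allI impI)
  have "(\<lambda>x. pfaff_int b (c - b) (a - c) (1 / (1 - x))) holomorphic_on cut_plane"
  proof (rule holomorphic_on_compose_gen[OF _ holomorphic_pfaff_int[OF bd], unfolded o_def])
    show "(\<lambda>x. 1 / (1 - x)) holomorphic_on cut_plane"
      by (intro holomorphic_intros) (auto simp: cut_plane_def)
    show "(\<lambda>x. 1 / (1 - x)) ` cut_plane \<subseteq> - \<real>\<^sub>\<le>\<^sub>0"
      using inverse_1_minus_slit by auto
  qed
  then show hol: "?F holomorphic_on cut_plane"
    by (intro holomorphic_intros) (auto simp: cut_plane_iff beta_int_neq_0[OF bd])
  fix x :: complex assume x: "norm x < 1"
  have real_x: "?F (of_real t) = gauss_series a b c (of_real t)" if t: "0 < t" "t < 1" for t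
    using pfaff_int_eq_euler_int[OF bd t, of a] euler_int_eq_gauss_series[OF bd t, of a] beta_int_neq_0[OF bd]
    by simp
  have "?F x - gauss_series a b c x = 0"
  proof (rule analytic_continuation[of "\<lambda>x. ?F x - gauss_series a b c x" "ball 0 1" "of_real ` {0<..<1}" 0])
    show "(\<lambda>x. ?F x - gauss_series a b c x) holomorphic_on ball 0 1"
      by (intro holomorphic_on_diff holomorphic_on_subset[OF hol] holomorphic_gauss_series
            unit_disc_subset_cut_plane)
    show "(0::complex) islimpt of_real ` {0<..<1}"
      unfolding islimpt_approachable
    proof safe
      fix e :: real assume "e > 0"
      then obtain t where "0 < t" "t < min e 1"
        using dense[of 0 "min e 1"] by auto
      then show "\<exists>x'\<in>complex_of_real ` {0<..<1}. x' \<noteq> 0 \<and> dist x' 0 < e"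
        by (intro bexI[of _ "of_real t"]) auto
    qed
  qed (use x real_x in auto)
  then show "?F x = gauss_series a b c x" by simp
qed

lemma continues_gauss_series_raise_c:
  assumes "c \<notin> \<int>\<^sub>\<le>\<^sub>0" "continues_gauss_series a b (c + 1) F"
    "continues_gauss_series (a + 1) (b + 1) (c + 2) G"
  shows "continues_gauss_series a b c (\<lambda>x. F x + a * b / (c * (c + 1)) * (x * G x))"
  using assms by (auto simp: continues_gauss_series_def gauss_series_raise_c intro!: holomorphic_intros)

lemma continues_gauss_series_raise_b:
  assumes "c \<notin> \<int>\<^sub>\<le>\<^sub>0" "continues_gauss_series a (b + 1) (c + 1) F"
    "continues_gauss_series (a + 1) (b + 1) (c + 2) G"
  shows "continues_gauss_series a b c (\<lambda>x. F x - a * (c - b) / (c * (c + 1)) * (x * G x))"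
  using assms by (auto simp: continues_gauss_series_def gauss_series_raise_b intro!: holomorphic_intros)

lemma hyp2f1_continues:
  assumes "c \<notin> \<int>\<^sub>\<le>\<^sub>0"
  shows "continues_gauss_series a b c (hyp2f1 a b c)"
proof -
  have "\<exists>F. continues_gauss_series a b c F"
    using assms
  proof (induction a b c rule: raise_b_c_induct)
    case (base a b c)
    then show ?case using continues_gauss_series_pfaff by blast
  next
    case (raise_c a b c)
    then obtain F G where "continues_gauss_series a b (c + 1) F"
      "continues_gauss_series (a + 1) (b + 1) (c + 2) G" by blast
    from continues_gauss_series_raise_c[OF raise_c(1) this] show ?case by blast
  next
    case (raise_b a b c)
    then obtain F G where "continues_gauss_series a (b + 1) (c + 1) F"
      "continues_gauss_series (a + 1) (b + 1) (c + 2) G" by blast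
    from continues_gauss_series_raise_b[OF raise_b(1) this] show ?case by blast
  qed
  then show ?thesis using continues_gauss_series_hyp2f1 by blast
qed

lemma hyp2f1_pfaff:
  assumes "Re b > 1" "Re (c - b) > 1" "x \<in> cut_plane"
  shows "hyp2f1 a b c x =
    (1 - x) powr (- b) * pfaff_int b (c - b) (a - c) (1 / (1 - x)) / beta_int b (c - b)"
  using assms by (intro hyp2f1_eqI continues_gauss_series_pfaff)

lemma hyp2f1_raise_c:
  assumes c: "c \<notin> \<int>\<^sub>\<le>\<^sub>0" and x: "x \<in> cut_plane"
  shows "hyp2f1 a b c x =
    hyp2f1 a b (c + 1) x + a * b / (c * (c + 1)) * (x * hyp2f1 (a + 1) (b + 1) (c + 2) x)"
  using c plus_nat_not_nonpos_Int[OF c, of 1] plus_nat_not_nonpos_Int[OF c, of 2]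
  by (intro hyp2f1_eqI[OF _ x] continues_gauss_series_raise_c hyp2f1_continues) auto

lemma hyp2f1_raise_b:
  assumes c: "c \<notin> \<int>\<^sub>\<le>\<^sub>0" and x: "x \<in> cut_plane"
  shows "hyp2f1 a b c x = hyp2f1 a (b + 1) (c + 1) x
    - a * (c - b) / (c * (c + 1)) * (x * hyp2f1 (a + 1) (b + 1) (c + 2) x)"
  using c plus_nat_not_nonpos_Int[OF c, of 1] plus_nat_not_nonpos_Int[OF c, of 2]
  by (intro hyp2f1_eqI[OF _ x] continues_gauss_series_raise_b hyp2f1_continues) auto

lemma hyp2f1_lower_a:
  assumes c: "c \<notin> \<int>\<^sub>\<le>\<^sub>0" and x: "x \<in> cut_plane"
  shows "(c - a - 1) * hyp2f1 a b c x =
    (c - 2 * a - 2 + (a + 1 - b) * x) * hyp2f1 (a + 1) b c x + (a + 1) * (1 - x) * hyp2f1 (a + 2) b c x"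
proof (rule analytic_continuation_open[of "ball 0 1" cut_plane "\<lambda>x. (c - a - 1) * hyp2f1 a b c x"])
  let ?r = "\<lambda>x. (c - 2 * a - 2 + (a + 1 - b) * x) * hyp2f1 (a + 1) b c x +
    (a + 1) * (1 - x) * hyp2f1 (a + 2) b c x"
  have hol: "hyp2f1 a b c holomorphic_on cut_plane" for a
    using hyp2f1_continues[OF c] by (simp add: continues_gauss_series_def)
  show "(\<lambda>x. (c - a - 1) * hyp2f1 a b c x) holomorphic_on cut_plane" "?r holomorphic_on cut_plane"
    by (intro holomorphic_intros hol)+
  fix z :: complex assume "z \<in> ball 0 1"
  then have "norm z < 1" by simp
  moreover from this have "hyp2f1 a b c z = gauss_series a b c z" for a
    using hyp2f1_continues[OF c] by (simp add: continues_gauss_series_def)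
  ultimately show "(c - a - 1) * hyp2f1 a b c z = ?r z"
    using gauss_series_lower_a[OF c, of z a b] by (simp add: algebra_simps)
qed (use x in \<open>simp_all add: open_cut_plane connected_cut_plane unit_disc_subset_cut_plane\<close>)

section \<open>Behaviour for large index and large argument\<close>

text \<open>
  The regime of a single term of the Humbert series: the index \<open>n\<close> and the argument \<open>x\<close> tend to
  infinity independently of each other.
\<close>

definition large_index_regime :: "(nat \<times> complex) filter" where
  "large_index_regime = at_top \<times>\<^sub>F inf at_infinity (principal cut_plane)"

lemma eventually_large_index_regime:
  "eventually (\<lambda>(n, x). n \<ge> N \<and> norm x \<ge> r \<and> x \<in> cut_plane) large_index_regime"
proof -
  have "eventually (\<lambda>x. norm x \<ge> r \<and> x \<in> cut_plane) (inf at_infinity (principal cut_plane))"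
    by (auto simp: eventually_inf_principal eventually_at_infinity)
  from eventually_prodI[OF eventually_ge_at_top[of N] this] show ?thesis
    unfolding large_index_regime_def case_prod_beta .
qed

text \<open>
  The regime has a countable basis, so sequences suffice; this makes dominated convergence
  applicable. The predicate \<open>P\<close> may be assumed along the whole sequence, not just eventually.
\<close>

lemma tendsto_large_index_regimeI:
  fixes f :: "nat \<Rightarrow> complex \<Rightarrow> 'a :: metric_space"
  assumes P: "eventually (\<lambda>(n, x). P n x) large_index_regime"
    and f: "\<And>N X. filterlim N at_top sequentially \<Longrightarrow> filterlim X at_infinity sequentially \<Longrightarrow>
      (\<And>k. X k \<in> cut_plane) \<Longrightarrow> (\<And>k. P (N k) (X k)) \<Longrightarrow> (\<lambda>k. f (N k) (X k)) \<longlonglongrightarrow> L"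
  shows "((\<lambda>(n, x). f n x) \<longlongrightarrow> L) large_index_regime"
proof (rule tendstoI, rule ccontr)
  fix e :: real assume "e > 0"
  assume far: "\<not> eventually (\<lambda>p. dist (case p of (n, x) \<Rightarrow> f n x) L < e) large_index_regime"
  have "\<exists>n x. n \<ge> k \<and> norm x \<ge> real k \<and> x \<in> cut_plane \<and> P n x \<and> \<not> dist (f n x) L < e" for k
  proof (rule ccontr)
    assume "\<not> ?thesis"
    then have "eventually (\<lambda>p. dist (case p of (n, x) \<Rightarrow> f n x) L < e) large_index_regime"
      using eventually_conj[OF P eventually_large_index_regime[of k "real k"]]
      by (auto elim!: eventually_mono)
    with far show False ..
  qed
  then obtain N X where NX: "\<And>k. N k \<ge> k" "\<And>k. norm (X k) \<ge> real k" "\<And>k. X k \<in> cut_plane"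
      "\<And>k. P (N k) (X k)" "\<And>k. \<not> dist (f (N k) (X k)) L < e"
    by metis
  have "filterlim N at_top sequentially"
    using NX(1) by (intro filterlim_at_top_mono[OF filterlim_ident]) auto
  moreover have "filterlim X at_infinity sequentially"
    unfolding filterlim_at_infinity_conv_norm_at_top
    using NX(2) by (intro filterlim_at_top_mono[OF filterlim_real_sequentially]) auto
  ultimately have "(\<lambda>k. f (N k) (X k)) \<longlonglongrightarrow> L"
    using NX by (intro f)
  from tendstoD[OF this \<open>e > 0\<close>] NX(5) show False by simp
qed

lemma filterlim_1_minus_at_infinity: "filterlim (\<lambda>x. 1 - x :: complex) at_infinity at_infinity"
  unfolding filterlim_at_infinity[OF order_refl]
proof (intro allI impI)
  fix r :: real
  have "norm (1 - x) \<ge> r" if "norm x \<ge> r + 1" for x :: complex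
    using norm_triangle_ineq2[of x 1] that by (simp add: norm_minus_commute)
  then show "eventually (\<lambda>x. r \<le> norm (1 - x :: complex)) at_infinity"
    unfolding eventually_at_infinity by blast
qed

lemma filterlim_fst_large_index_regime: "filterlim fst at_top large_index_regime"
  unfolding large_index_regime_def by (rule filterlim_fst)

lemma filterlim_snd_large_index_regime: "filterlim snd at_infinity large_index_regime"
  unfolding large_index_regime_def
  by (rule filterlim_mono[OF filterlim_snd inf_le1 order_refl])

lemma large_index_regime_limits:
  shows "((\<lambda>p. (a + of_nat (fst p)) / of_nat (fst p) :: complex) \<longlongrightarrow> 1) large_index_regime" (is ?A)
    and "((\<lambda>p. snd p / (1 - snd p)) \<longlongrightarrow> - 1) large_index_regime" (is ?B)
    and "((\<lambda>p. 1 / of_nat (fst p) * (1 / (1 - snd p)) :: complex) \<longlongrightarrow> 0) large_index_regime" (is ?C)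
proof -
  have inv_w: "((\<lambda>p. 1 / (1 - snd p)) \<longlongrightarrow> 0) large_index_regime"
    using filterlim_compose[OF tendsto_inverse_0 filterlim_compose[OF filterlim_1_minus_at_infinity
      filterlim_snd_large_index_regime]] by (simp add: inverse_eq_divide)
  show ?A
    using filterlim_compose[OF of_nat_shift_ratio_tendsto_1[of a 0] filterlim_fst_large_index_regime]
    by simp
  have "((\<lambda>p. 1 / (1 - snd p) - 1) \<longlongrightarrow> 0 - 1) large_index_regime"
    by (intro tendsto_intros inv_w)
  moreover have "eventually (\<lambda>p. 1 / (1 - snd p) - 1 = snd p / (1 - snd p)) large_index_regime"
    using eventually_large_index_regime[of 0 0]
    by eventually_elim (auto simp: cut_plane_def field_simps)
  ultimately show ?B
    using Lim_transform_eventually by fastforce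
  have "((\<lambda>p. 1 / of_nat (fst p) * (1 / (1 - snd p)) :: complex) \<longlongrightarrow> 0 * 0) large_index_regime"
    by (intro tendsto_mult inv_w filterlim_compose[OF lim_1_over_n filterlim_fst_large_index_regime])
  then show ?C by simp
qed

lemma pfaff_int_asymptotic:
  assumes bd: "Re b > 1" "Re d > 1"
  shows "((\<lambda>(n, x). of_nat n powr b * pfaff_int b d (of_nat n + e) (1 / (1 - x))) \<longlongrightarrow> Gamma b)
    large_index_regime"
proof -
  \<comment> \<open>This bound makes the real part of the exponent at least half the index.\<close>
  obtain M :: nat where M: "real M > 2 * \<bar>Re e\<bar> + 1" using reals_Archimedean2 by blast
  show ?thesis
  proof (rule tendsto_large_index_regimeI[where P = "\<lambda>n x. n \<ge> M \<and> norm x \<ge> 3 \<and> x \<in> cut_plane"])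
    show "eventually (\<lambda>(n, x). n \<ge> M \<and> norm x \<ge> 3 \<and> x \<in> cut_plane) large_index_regime"
      by (rule eventually_large_index_regime)
    fix N :: "nat \<Rightarrow> nat" and X :: "nat \<Rightarrow> complex"
    assume N: "filterlim N at_top sequentially" and X: "filterlim X at_infinity sequentially"
      and cut: "\<And>k. X k \<in> cut_plane" and P: "\<And>k. N k \<ge> M \<and> norm (X k) \<ge> 3 \<and> X k \<in> cut_plane"
    show "(\<lambda>k. of_nat (N k) powr b * pfaff_int b d (of_nat (N k) + e) (1 / (1 - X k))) \<longlonglongrightarrow> Gamma b"
    proof (rule pfaff_int_dominated_limit[OF bd N])
      have "(\<lambda>k. inverse (1 - X k)) \<longlonglongrightarrow> 0"
        by (rule filterlim_compose[OF tendsto_inverse_0])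
           (rule filterlim_compose[OF filterlim_1_minus_at_infinity X])
      then show "(\<lambda>k. 1 / (1 - X k)) \<longlonglongrightarrow> 0" by (simp add: inverse_eq_divide)
      fix k
      show "1 / (1 - X k) \<notin> \<real>\<^sub>\<le>\<^sub>0 \<or> 1 / (1 - X k) = 0"
        using inverse_1_minus_slit[OF cut] by simp
      have "norm (1 - X k) \<ge> 2"
        using norm_triangle_ineq2[of "X k" 1] P[of k] by (simp add: norm_minus_commute)
      then show "norm (1 / (1 - X k)) \<le> 1 / 2"
        unfolding norm_divide norm_one by (intro frac_le) auto
      have NM: "real (N k) \<ge> real M" using P[of k] by simp
      then show "N k > 0" using M by linarith
      show "Re (of_nat (N k) + e) \<ge> real (N k) / 2"
        using NM M by (simp add: abs_if split: if_splits)
    qed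
  qed
qed

lemma tendsto_eventually_eq:
  assumes "(f \<longlongrightarrow> l) F" "l = l'" "eventually (\<lambda>x. f x = g x) F"
  shows "(g \<longlongrightarrow> l') F"
  using Lim_transform_eventually[OF assms(1,3)] assms(2) by simp

text \<open>
  Where the Pfaff integral is available this is Watson's lemma, and the quotient of the Gamma values
  comes from the Beta integral that normalises it. In the two raising relations the factor
  \<^term>\<open>(a + of_nat n) * x\<close> of the second term compensates for the extra factor \<^term>\<open>of_nat n * (1 - x)\<close>
  which belongs to the parameter \<^term>\<open>b + 1\<close>, up to the sign of \<open>x / (1 - x) \<rightarrow> - 1\<close>; the first term of
  the relation in \<open>b\<close> loses that factor and vanishes in the limit.
\<close>

lemma hyp2f1_asymptotic:
  assumes "c \<notin> \<int>\<^sub>\<le>\<^sub>0"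
  shows "((\<lambda>(n, x). of_nat n powr b * (1 - x) powr b * hyp2f1 (a + of_nat n) b c x)
    \<longlongrightarrow> Gamma c * rGamma (c - b)) large_index_regime"
  using assms
proof (induction a b c rule: raise_b_c_induct)
  case (base a b c)
  define d where "d = c - b"
  have bd: "Re b > 1" "Re d > 1" using base by (auto simp: d_def)
  have "((\<lambda>p. of_nat (fst p) powr b * pfaff_int b d (of_nat (fst p) + (a - c)) (1 / (1 - snd p))
      / beta_int b d) \<longlongrightarrow> Gamma b / beta_int b d) large_index_regime"
    using pfaff_int_asymptotic[OF bd, of "a - c", unfolded case_prod_unfold]
    by (intro tendsto_divide tendsto_const beta_int_neq_0 bd)
  moreover have "Gamma b / beta_int b d = Gamma c * rGamma (c - b)"
    using bd Re_gt_1_not_nonpos_Int[of b] Re_gt_1_not_nonpos_Int[of d]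
    by (subst beta_int_eq) (auto simp: d_def Gamma_eq_zero_iff rGamma_inverse_Gamma field_simps)
  moreover have "eventually (\<lambda>p. of_nat (fst p) powr b *
      pfaff_int b d (of_nat (fst p) + (a - c)) (1 / (1 - snd p)) / beta_int b d =
      (case p of (n, x) \<Rightarrow> of_nat n powr b * (1 - x) powr b * hyp2f1 (a + of_nat n) b c x))
      large_index_regime"
    using eventually_large_index_regime[of 0 0]
  proof eventually_elim
    case (elim p)
    obtain n x where p: "p = (n, x)" by force
    have x: "x \<in> cut_plane" using elim p by simp
    then have cancel: "(1 - x) powr b * ((1 - x) powr (- b) * z) = z" for z
      by (simp add: powr_minus cut_plane_def)
    have e: "a + of_nat n - c = of_nat n + (a - c)" by simp
    have "hyp2f1 (a + of_nat n) b c x =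
        (1 - x) powr (- b) * (pfaff_int b d (of_nat n + (a - c)) (1 / (1 - x)) / beta_int b d)"
      using hyp2f1_pfaff[of b c x "a + of_nat n"] bd x unfolding e d_def by simp
    then show ?case
      unfolding p by (simp add: mult.assoc cancel)
  qed
  ultimately show ?case
    by (rule tendsto_eventually_eq)
next
  case (raise_c a b c)
  let ?w = "\<lambda>p :: nat \<times> complex. 1 - snd p"
  have c0: "c \<noteq> 0" "c + 1 \<noteq> 0"
    using plus_nat_neq_0[OF raise_c.hyps, of 0] plus_nat_neq_0[OF raise_c.hyps, of 1] by auto
  have "((\<lambda>p. of_nat (fst p) powr b * ?w p powr b * hyp2f1 (a + of_nat (fst p)) b (c + 1) (snd p) +
      ((a + of_nat (fst p)) / of_nat (fst p)) * (snd p / ?w p) * (b / (c * (c + 1))) *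
      (of_nat (fst p) powr (b + 1) * ?w p powr (b + 1) *
       hyp2f1 (a + 1 + of_nat (fst p)) (b + 1) (c + 2) (snd p))) \<longlongrightarrow>
      Gamma (c + 1) * rGamma (c + 1 - b) +
      1 * - 1 * (b / (c * (c + 1))) * (Gamma (c + 2) * rGamma (c + 2 - (b + 1)))) large_index_regime"
    using raise_c.IH[unfolded case_prod_unfold]
    by (intro tendsto_add tendsto_mult[OF tendsto_mult[OF tendsto_mult]] tendsto_const
          large_index_regime_limits)
  moreover have "Gamma (c + 1) * rGamma (c + 1 - b) +
      1 * - 1 * (b / (c * (c + 1))) * (Gamma (c + 2) * rGamma (c + 2 - (b + 1))) =
      Gamma c * rGamma (c - b)"
  proof -
    have G: "Gamma (c + 1) = c * Gamma c" "Gamma (c + 2) = (c + 1) * (c * Gamma c)"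
      using Gamma_plus1[of c] Gamma_plus1[of "c + 1"] raise_c.hyps
        plus_nat_not_nonpos_Int[OF raise_c.hyps, of 1] by (auto simp: add.assoc)
    have R: "rGamma (c - b) = (c - b) * rGamma (c + 1 - b)" "c + 2 - (b + 1) = c + 1 - b"
      using rGamma_plus1[of "c - b"] by (auto simp: algebra_simps)
    have key: "k / (c * (c + 1)) * ((c + 1) * (c * g) * r) = k * (g * r)" for k g r
      using c0 by simp
    show ?thesis
      unfolding G R mult_1 mult_minus1 mult_minus_left key by (simp add: algebra_simps)
  qed
  moreover have "eventually (\<lambda>p. of_nat (fst p) powr b * ?w p powr b * hyp2f1 (a + of_nat (fst p)) b (c + 1) (snd p) +
      ((a + of_nat (fst p)) / of_nat (fst p)) * (snd p / ?w p) * (b / (c * (c + 1))) *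
      (of_nat (fst p) powr (b + 1) * ?w p powr (b + 1) *
       hyp2f1 (a + 1 + of_nat (fst p)) (b + 1) (c + 2) (snd p)) =
      (case p of (n, x) \<Rightarrow> of_nat n powr b * (1 - x) powr b * hyp2f1 (a + of_nat n) b c x))
      large_index_regime"
    using eventually_large_index_regime[of 1 0]
  proof eventually_elim
    case (elim p)
    obtain n x where p: "p = (n, x)" by force
    have n: "of_nat n \<noteq> (0::complex)" and x: "x \<in> cut_plane" and w: "1 - x \<noteq> 0"
      using elim p by (auto simp: cut_plane_def)
    have e: "a + 1 + of_nat n = a + of_nat n + 1" by simp
    have p1: "z powr (b + 1) = z * z powr b" for z :: complex
      using powr_eq_times_powr[of z "b + 1"] by simp
    have cancel: "(A / of_nat n) * (x / (1 - x)) * B * ((of_nat n * N) * ((1 - x) * W) * G) =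
        A * x * B * (N * W * G)" for A B N W G
    proof -
      have "(A / of_nat n) * (x / (1 - x)) * B * ((of_nat n * N) * ((1 - x) * W) * G) =
          (A / of_nat n * of_nat n) * (x / (1 - x) * (1 - x)) * B * (N * W * G)"
        by (simp only: mult_ac)
      then show ?thesis using n w by simp
    qed
    define A where "A = a + of_nat n"
    show ?case
      unfolding p prod.case fst_conv snd_conv hyp2f1_raise_c[OF raise_c.hyps x, of "a + of_nat n" b]
        e p1 cancel unfolding A_def[symmetric]
      by (simp only: distrib_left times_divide_eq_left times_divide_eq_right mult_ac)
  qed
  ultimately show ?case
    by (rule tendsto_eventually_eq)
next
  case (raise_b a b c)
  let ?w = "\<lambda>p :: nat \<times> complex. 1 - snd p"
  have c0: "c \<noteq> 0" "c + 1 \<noteq> 0"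
    using plus_nat_neq_0[OF raise_b.hyps, of 0] plus_nat_neq_0[OF raise_b.hyps, of 1] by auto
  have "((\<lambda>p. (1 / of_nat (fst p) * (1 / ?w p)) * (of_nat (fst p) powr (b + 1) * ?w p powr (b + 1) *
       hyp2f1 (a + of_nat (fst p)) (b + 1) (c + 1) (snd p)) -
      ((a + of_nat (fst p)) / of_nat (fst p)) * (snd p / ?w p) * ((c - b) / (c * (c + 1))) *
      (of_nat (fst p) powr (b + 1) * ?w p powr (b + 1) *
       hyp2f1 (a + 1 + of_nat (fst p)) (b + 1) (c + 2) (snd p))) \<longlongrightarrow>
      0 * (Gamma (c + 1) * rGamma (c + 1 - (b + 1))) -
      1 * - 1 * ((c - b) / (c * (c + 1))) * (Gamma (c + 2) * rGamma (c + 2 - (b + 1)))) large_index_regime"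
    using raise_b.IH[unfolded case_prod_unfold]
    by (intro tendsto_diff tendsto_mult[OF large_index_regime_limits(3)]
          tendsto_mult[OF tendsto_mult[OF tendsto_mult]] tendsto_const large_index_regime_limits)
  moreover have "0 * (Gamma (c + 1) * rGamma (c + 1 - (b + 1))) -
      1 * - 1 * ((c - b) / (c * (c + 1))) * (Gamma (c + 2) * rGamma (c + 2 - (b + 1))) =
      Gamma c * rGamma (c - b)"
  proof -
    have G: "Gamma (c + 2) = (c + 1) * (c * Gamma c)"
      using Gamma_plus1[of c] Gamma_plus1[of "c + 1"] raise_b.hyps
        plus_nat_not_nonpos_Int[OF raise_b.hyps, of 1] by (auto simp: add.assoc)
    have R: "rGamma (c - b) = (c - b) * rGamma (c + 1 - b)" "c + 2 - (b + 1) = c + 1 - b"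
      using rGamma_plus1[of "c - b"] by (auto simp: algebra_simps)
    have key: "k / (c * (c + 1)) * ((c + 1) * (c * g) * r) = k * (g * r)" for k g r
      using c0 by simp
    show ?thesis
      unfolding G R mult_1 mult_minus1 mult_minus_left key by (simp add: mult_ac)
  qed
  moreover have "eventually (\<lambda>p. (1 / of_nat (fst p) * (1 / ?w p)) * (of_nat (fst p) powr (b + 1) * ?w p powr (b + 1) *
       hyp2f1 (a + of_nat (fst p)) (b + 1) (c + 1) (snd p)) -
      ((a + of_nat (fst p)) / of_nat (fst p)) * (snd p / ?w p) * ((c - b) / (c * (c + 1))) *
      (of_nat (fst p) powr (b + 1) * ?w p powr (b + 1) *
       hyp2f1 (a + 1 + of_nat (fst p)) (b + 1) (c + 2) (snd p)) =
      (case p of (n, x) \<Rightarrow> of_nat n powr b * (1 - x) powr b * hyp2f1 (a + of_nat n) b c x))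
      large_index_regime"
    using eventually_large_index_regime[of 1 0]
  proof eventually_elim
    case (elim p)
    obtain n x where p: "p = (n, x)" by force
    have n: "of_nat n \<noteq> (0::complex)" and x: "x \<in> cut_plane" and w: "1 - x \<noteq> 0"
      using elim p by (auto simp: cut_plane_def)
    have e: "a + 1 + of_nat n = a + of_nat n + 1" by simp
    have p1: "z powr (b + 1) = z * z powr b" for z :: complex
      using powr_eq_times_powr[of z "b + 1"] by simp
    have cancel: "(A / of_nat n) * (x / (1 - x)) * B * ((of_nat n * N) * ((1 - x) * W) * G) =
        A * x * B * (N * W * G)" for A B N W G
    proof -
      have "(A / of_nat n) * (x / (1 - x)) * B * ((of_nat n * N) * ((1 - x) * W) * G) =
          (A / of_nat n * of_nat n) * (x / (1 - x) * (1 - x)) * B * (N * W * G)"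
        by (simp only: mult_ac)
      then show ?thesis using n w by simp
    qed
    have cancel': "(1 / of_nat n * (1 / (1 - x))) * ((of_nat n * N) * ((1 - x) * W) * G) = N * W * G"
      for N W G
    proof -
      have "(1 / of_nat n * (1 / (1 - x))) * ((of_nat n * N) * ((1 - x) * W) * G) =
          (1 / of_nat n * of_nat n) * (1 / (1 - x) * (1 - x)) * (N * W * G)"
        by (simp only: mult_ac)
      then show ?thesis using n w by simp
    qed
    show ?case
      unfolding p prod.case fst_conv snd_conv hyp2f1_raise_b[OF raise_b.hyps x, of "a + of_nat n" b]
        e p1 cancel cancel' by (simp only: right_diff_distrib times_divide_eq_left times_divide_eq_right mult_ac)
  qed
  ultimately show ?case
    by (rule tendsto_eventually_eq)
qed

text \<open>
  Polynomial growth in the index and in \<^term>\<open>norm (1 - x)\<close>, uniformly up to the cut. It suffices for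
  the terms far from the maximum of the Poisson weights. The distance 2 keeps \<open>x\<close> away from the
  singularity at 1 and makes the base of the power at least 1, so that exponents may be enlarged.
\<close>

definition poly_bounded :: "(nat \<Rightarrow> complex \<Rightarrow> complex) \<Rightarrow> bool" where
  "poly_bounded f \<longleftrightarrow> (\<exists>C m. \<forall>n. \<forall>x\<in>cut_plane. norm (1 - x) \<ge> 2 \<longrightarrow>
     norm (f n x) \<le> C * (norm (1 - x) * (1 + real n)) ^ m)"

lemma poly_boundedE:
  assumes "poly_bounded f"
  obtains C m where "C \<ge> 0" "\<And>n x. x \<in> cut_plane \<Longrightarrow> norm (1 - x) \<ge> 2 \<Longrightarrow>
     norm (f n x) \<le> C * (norm (1 - x) * (1 + real n)) ^ m"
proof -
  obtain C m where C: "\<forall>n. \<forall>x\<in>cut_plane. norm (1 - x) \<ge> 2 \<longrightarrow>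
     norm (f n x) \<le> C * (norm (1 - x) * (1 + real n)) ^ m"
    using assms unfolding poly_bounded_def by blast
  show thesis
  proof (rule that[of "max C 0" m])
    fix n and x assume x: "x \<in> cut_plane" "norm (1 - x) \<ge> 2"
    have "C * (norm (1 - x) * (1 + real n)) ^ m \<le> max C 0 * (norm (1 - x) * (1 + real n)) ^ m"
      by (intro mult_right_mono) auto
    then show "norm (f n x) \<le> max C 0 * (norm (1 - x) * (1 + real n)) ^ m"
      using C x by (meson order_trans)
  qed simp
qed

lemma poly_bounded_scale_ge_1: "norm (1 - x) \<ge> 2 \<Longrightarrow> norm (1 - x) * (1 + real n) \<ge> 1"
  using mult_mono[of 1 "norm (1 - x)" 1 "1 + real n"] by simp

lemma poly_bounded_const: "poly_bounded (\<lambda>_ _. k)"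
  unfolding poly_bounded_def by (intro exI[of _ "norm k"] exI[of _ 0]) auto

lemma poly_bounded_of_nat: "poly_bounded (\<lambda>n _. of_nat n)"
  unfolding poly_bounded_def
proof (intro exI[of _ "1::real"] exI[of _ "1::nat"] allI ballI impI)
  fix n x assume "norm (1 - x :: complex) \<ge> 2"
  then have "1 * (1 + real n) \<le> norm (1 - x) * (1 + real n)"
    by (intro mult_right_mono) auto
  then have "1 + real n \<le> norm (1 - x) * (1 + real n)" by (simp only: mult_1)
  then have "real n \<le> norm (1 - x) * (1 + real n)" by linarith
  then show "norm (of_nat n :: complex) \<le> 1 * (norm (1 - x) * (1 + real n)) ^ 1"
    by (simp only: norm_of_nat power_one_right mult_1)
qed

lemma poly_bounded_arg: "poly_bounded (\<lambda>_ x. x)"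
  unfolding poly_bounded_def
proof (intro exI[of _ "2::real"] exI[of _ "1::nat"] allI ballI impI)
  fix n :: nat and x :: complex assume x: "norm (1 - x) \<ge> 2"
  have "norm x \<le> 1 + norm (1 - x)"
    using norm_triangle_ineq4[of 1 "1 - x"] by simp
  also have "\<dots> \<le> 2 * (norm (1 - x) * 1)" using x by simp
  also have "\<dots> \<le> 2 * (norm (1 - x) * (1 + real n))"
    by (intro mult_left_mono) auto
  finally show "norm x \<le> 2 * (norm (1 - x) * (1 + real n)) ^ 1" by simp
qed

lemma poly_bounded_add:
  assumes "poly_bounded f" "poly_bounded g"
  shows "poly_bounded (\<lambda>n x. f n x + g n x)"
proof -
  obtain C m where f: "C \<ge> 0" "\<And>n x. x \<in> cut_plane \<Longrightarrow> norm (1 - x) \<ge> 2 \<Longrightarrow>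
      norm (f n x) \<le> C * (norm (1 - x) * (1 + real n)) ^ m"
    using poly_boundedE[OF assms(1)] by blast
  obtain D k where g: "D \<ge> 0" "\<And>n x. x \<in> cut_plane \<Longrightarrow> norm (1 - x) \<ge> 2 \<Longrightarrow>
      norm (g n x) \<le> D * (norm (1 - x) * (1 + real n)) ^ k"
    using poly_boundedE[OF assms(2)] by blast
  show ?thesis
    unfolding poly_bounded_def
  proof (intro exI allI ballI impI)
    fix n x assume x: "x \<in> cut_plane" "norm (1 - x) \<ge> 2"
    let ?X = "norm (1 - x) * (1 + real n)"
    have X: "?X \<ge> 1" by (rule poly_bounded_scale_ge_1[OF x(2)])
    have "norm (f n x + g n x) \<le> C * ?X ^ m + D * ?X ^ k"
      by (intro norm_triangle_mono f g x)
    also have "\<dots> \<le> C * ?X ^ max m k + D * ?X ^ max m k"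
      using X f(1) g(1) by (intro add_mono mult_left_mono power_increasing) auto
    finally show "norm (f n x + g n x) \<le> (C + D) * ?X ^ max m k"
      by (simp add: distrib_right)
  qed
qed

lemma poly_bounded_mult:
  assumes "poly_bounded f" "poly_bounded g"
  shows "poly_bounded (\<lambda>n x. f n x * g n x)"
proof -
  obtain C m where f: "C \<ge> 0" "\<And>n x. x \<in> cut_plane \<Longrightarrow> norm (1 - x) \<ge> 2 \<Longrightarrow>
      norm (f n x) \<le> C * (norm (1 - x) * (1 + real n)) ^ m"
    using poly_boundedE[OF assms(1)] by blast
  obtain D k where g: "D \<ge> 0" "\<And>n x. x \<in> cut_plane \<Longrightarrow> norm (1 - x) \<ge> 2 \<Longrightarrow>
      norm (g n x) \<le> D * (norm (1 - x) * (1 + real n)) ^ k"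
    using poly_boundedE[OF assms(2)] by blast
  show ?thesis
    unfolding poly_bounded_def
  proof (intro exI allI ballI impI)
    fix n x assume x: "x \<in> cut_plane" "norm (1 - x) \<ge> 2"
    let ?X = "norm (1 - x) * (1 + real n)"
    have "norm (f n x * g n x) \<le> (C * ?X ^ m) * (D * ?X ^ k)"
      unfolding norm_mult using f(1) by (intro mult_mono f g x) auto
    then show "norm (f n x * g n x) \<le> (C * D) * ?X ^ (m + k)"
      by (simp add: power_add mult_ac)
  qed
qed

lemma poly_bounded_fixed_index:
  assumes "poly_bounded f"
  shows "poly_bounded (\<lambda>_. f k)"
proof -
  obtain C m where f: "C \<ge> 0" "\<And>n x. x \<in> cut_plane \<Longrightarrow> norm (1 - x) \<ge> 2 \<Longrightarrow>
      norm (f n x) \<le> C * (norm (1 - x) * (1 + real n)) ^ m"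
    using poly_boundedE[OF assms] by blast
  show ?thesis
    unfolding poly_bounded_def
  proof (intro exI allI ballI impI)
    fix n :: nat and x assume x: "x \<in> cut_plane" "norm (1 - x) \<ge> 2"
    have "1 + real k \<le> (1 + real k) * (1 + real n)" by (simp add: algebra_simps)
    then have "norm (1 - x) * (1 + real k) \<le> norm (1 - x) * ((1 + real k) * (1 + real n))"
      by (rule mult_left_mono) auto
    then have "(norm (1 - x) * (1 + real k)) ^ m \<le> ((1 + real k) * (norm (1 - x) * (1 + real n))) ^ m"
      by (intro power_mono) (auto simp: mult_ac)
    then have "C * (norm (1 - x) * (1 + real k)) ^ m \<le>
        C * ((1 + real k) * (norm (1 - x) * (1 + real n))) ^ m"
      using f(1) by (rule mult_left_mono)
    with f(2)[OF x, of k] show "norm (f k x) \<le> (C * (1 + real k) ^ m) * (norm (1 - x) * (1 + real n)) ^ m"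
      by (simp add: power_mult_distrib mult_ac)
  qed
qed

lemma poly_bounded_Suc_index:
  assumes "poly_bounded (\<lambda>_. f 0)" "poly_bounded (\<lambda>n. f (Suc n))"
  shows "poly_bounded f"
proof -
  obtain C m where f: "C \<ge> 0" "\<And>n x. x \<in> cut_plane \<Longrightarrow> norm (1 - x) \<ge> 2 \<Longrightarrow>
      norm (f 0 x) \<le> C * (norm (1 - x) * (1 + real n)) ^ m"
    using poly_boundedE[OF assms(1)] by blast
  obtain D k where g: "D \<ge> 0" "\<And>n x. x \<in> cut_plane \<Longrightarrow> norm (1 - x) \<ge> 2 \<Longrightarrow>
      norm (f (Suc n) x) \<le> D * (norm (1 - x) * (1 + real n)) ^ k"
    using poly_boundedE[OF assms(2)] by blast
  show ?thesis
    unfolding poly_bounded_def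
  proof (intro exI allI ballI impI)
    fix n x assume x: "x \<in> cut_plane" "norm (1 - x) \<ge> 2"
    let ?X = "norm (1 - x) * (1 + real n)"
    have X: "?X \<ge> 1" by (rule poly_bounded_scale_ge_1[OF x(2)])
    have p: "C * ?X ^ m \<le> C * ?X ^ max m k" "D * ?X ^ k \<le> D * ?X ^ max m k"
      using X f(1) g(1) by (intro mult_left_mono power_increasing; simp)+
    have nn: "0 \<le> C * ?X ^ max m k" "0 \<le> D * ?X ^ max m k" using f(1) g(1) by auto
    show "norm (f n x) \<le> (C + D) * ?X ^ max m k"
    proof (cases n)
      case 0
      then show ?thesis using f(2)[OF x, of n] p nn unfolding distrib_right by simp
    next
      case (Suc l)
      have "norm (f n x) \<le> D * (norm (1 - x) * (1 + real l)) ^ k"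
        using g(2)[OF x, of l] Suc by simp
      also have "\<dots> \<le> D * ?X ^ k"
        using g(1) Suc by (intro mult_left_mono power_mono) auto
      finally show ?thesis using p nn unfolding distrib_right by linarith
    qed
  qed
qed

lemma poly_bounded_cong:
  assumes "poly_bounded g" "\<And>n x. x \<in> cut_plane \<Longrightarrow> f n x = g n x"
  shows "poly_bounded f"
  using assms unfolding poly_bounded_def by simp

lemma poly_bounded_hyp2f1_lower_a:
  assumes c: "c \<notin> \<int>\<^sub>\<le>\<^sub>0" and a: "c - a - 1 \<noteq> 0"
    and B: "poly_bounded (\<lambda>n. hyp2f1 (a + 1 + of_nat n) b c)"
  shows "poly_bounded (\<lambda>n. hyp2f1 (a + of_nat n) b c)"
proof (rule poly_bounded_Suc_index)
  show "poly_bounded (\<lambda>n. hyp2f1 (a + of_nat (Suc n)) b c)"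
    using B by (simp add: add_ac)
  have B0: "poly_bounded (\<lambda>_. hyp2f1 (a + 1) b c)"
    using poly_bounded_fixed_index[OF B, of 0] by simp
  have B1: "poly_bounded (\<lambda>_. hyp2f1 (a + 2) b c)"
    using poly_bounded_fixed_index[OF B, of 1] by (simp add: add.assoc)
  have "poly_bounded (\<lambda>_ x. (1 / (c - a - 1)) * ((c - 2 * a - 2 + (a + 1 - b) * x) * hyp2f1 (a + 1) b c x +
      (a + 1) * (1 + (- 1) * x) * hyp2f1 (a + 2) b c x))"
    by (intro poly_bounded_add poly_bounded_mult poly_bounded_const poly_bounded_arg B0 B1)
  then show "poly_bounded (\<lambda>_. hyp2f1 (a + of_nat 0) b c)"
  proof (rule poly_bounded_cong)
    fix x assume "x \<in> cut_plane"
    from hyp2f1_lower_a[OF c this, of a b]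
    show "hyp2f1 (a + of_nat 0) b c x = (1 / (c - a - 1)) *
        ((c - 2 * a - 2 + (a + 1 - b) * x) * hyp2f1 (a + 1) b c x +
         (a + 1) * (1 + (- 1) * x) * hyp2f1 (a + 2) b c x)"
      using a by (simp add: nonzero_eq_divide_eq mult.commute)
  qed
qed

lemma not_Ints_plus_1:
  assumes "z \<notin> \<int>" shows "z + 1 \<notin> (\<int> :: complex set)"
  using Ints_diff[of "z + 1" 1] assms by auto

lemma not_Ints_minus_1:
  assumes "z \<notin> \<int>" shows "z - 1 \<notin> (\<int> :: complex set)"
  using Ints_add[of "z - 1" 1] assms by auto

text \<open>
  If \<^term>\<open>Re (a - c) \<ge> 0\<close>, the Pfaff integrand is bounded. From there the relation in \<open>a\<close> leads
  downwards in finitely many steps; each divides by a number \<^term>\<open>c - a - 1\<close>, which is nonzero as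
  \<^term>\<open>a - c\<close> is not an integer. Only index 0 is new in each step.
\<close>

lemma poly_bounded_hyp2f1:
  assumes "c \<notin> \<int>\<^sub>\<le>\<^sub>0" and "a - c \<notin> \<int>"
  shows "poly_bounded (\<lambda>n. hyp2f1 (a + of_nat n) b c)"
  using assms
proof (induction a b c rule: raise_b_c_induct)
  case (base a b c)
  have bound: "poly_bounded (\<lambda>n. hyp2f1 (a + of_nat n) b c)" if "Re (a - c) \<ge> - real k" "a - c \<notin> \<int>" for k a
    using that
  proof (induction k arbitrary: a)
    case (Suc k)
    have not_int: "a + 1 - c \<notin> \<int>"
      using not_Ints_plus_1[OF Suc.prems(2)] by (simp add: algebra_simps)
    have nonzero: "c - a - 1 \<noteq> 0"
    proof
      assume "c - a - 1 = 0"
      then have "a - c = - 1" by (simp add: algebra_simps)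
      with Suc.prems(2) show False by simp
    qed
    have "Re (a + 1 - c) \<ge> - real k" using Suc.prems(1) by simp
    from Suc.IH[OF this not_int] show ?case
      by (rule poly_bounded_hyp2f1_lower_a[OF base.hyps(1) nonzero])
  next
    case 0
    define d where "d = c - b"
    define C where "C = exp (pi * \<bar>Im b\<bar>) * exp (pi * \<bar>Im (a - c)\<bar>) / norm (beta_int b d)"
    have "norm (hyp2f1 (a + of_nat n) b c x) \<le> C * (norm (1 - x) * (1 + real n)) ^ 0"
      if x: "x \<in> cut_plane" "norm (1 - x) \<ge> 2" for n x
    proof -
      have "norm ((1 - x) powr (- b)) \<le> norm (1 - x) powr (- Re b) * exp (pi * \<bar>Im b\<bar>)"
        using norm_powr_le[of "1 - x" "- b"] by simp
      also have "norm (1 - x) powr (- Re b) \<le> norm (1 - x) powr 0"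
        using x base(2) by (intro powr_mono) auto
      also have "norm (1 - x) powr 0 = 1" using x by auto
      finally have 1: "norm ((1 - x) powr (- b)) \<le> exp (pi * \<bar>Im b\<bar>)" by simp
      have "norm (pfaff_int b d (a + of_nat n - c) (1 / (1 - x))) \<le> exp (pi * \<bar>Im (a + of_nat n - c)\<bar>)"
        using base 0 x inverse_1_minus_slit[OF x(1)]
        by (intro norm_pfaff_int_le) (auto simp: d_def norm_divide divide_le_eq_1)
      then have 2: "norm (pfaff_int b d (a + of_nat n - c) (1 / (1 - x))) \<le> exp (pi * \<bar>Im (a - c)\<bar>)"
        by simp
      have "norm (hyp2f1 (a + of_nat n) b c x) = norm ((1 - x) powr (- b)) *
          norm (pfaff_int b d (a + of_nat n - c) (1 / (1 - x))) / norm (beta_int b d)"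
        using hyp2f1_pfaff[of b c x "a + of_nat n"] base x by (simp add: d_def norm_mult norm_divide)
      also have "\<dots> \<le> exp (pi * \<bar>Im b\<bar>) * exp (pi * \<bar>Im (a - c)\<bar>) / norm (beta_int b d)"
        by (intro divide_right_mono mult_mono 1 2) auto
      finally show ?thesis by (simp add: C_def)
    qed
    then show ?case unfolding poly_bounded_def by blast
  qed
  obtain k where "real k > - Re (a - c)" using reals_Archimedean2 by blast
  then show ?case using base.prems by (intro bound[of k]) auto
next
  case (raise_c a b c)
  have "a - (c + 1) \<notin> \<int>" "a + 1 - (c + 2) \<notin> \<int>"
    using not_Ints_minus_1[OF raise_c.prems] by (simp_all add: algebra_simps)
  then have IH: "poly_bounded (\<lambda>n. hyp2f1 (a + of_nat n) b (c + 1))"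
      "poly_bounded (\<lambda>n. hyp2f1 (a + 1 + of_nat n) (b + 1) (c + 2))"
    using raise_c.IH by auto
  have "poly_bounded (\<lambda>n x. hyp2f1 (a + of_nat n) b (c + 1) x +
      ((a + of_nat n) * (b / (c * (c + 1)))) * (x * hyp2f1 (a + 1 + of_nat n) (b + 1) (c + 2) x))"
    by (intro poly_bounded_add poly_bounded_mult poly_bounded_const poly_bounded_of_nat poly_bounded_arg IH)
  then show ?case
    by (rule poly_bounded_cong) (simp add: hyp2f1_raise_c[OF raise_c.hyps] add_ac)
next
  case (raise_b a b c)
  have "a - (c + 1) \<notin> \<int>" "a + 1 - (c + 2) \<notin> \<int>"
    using not_Ints_minus_1[OF raise_b.prems] by (simp_all add: algebra_simps)
  then have IH: "poly_bounded (\<lambda>n. hyp2f1 (a + of_nat n) (b + 1) (c + 1))"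
      "poly_bounded (\<lambda>n. hyp2f1 (a + 1 + of_nat n) (b + 1) (c + 2))"
    using raise_b.IH by auto
  have "poly_bounded (\<lambda>n x. hyp2f1 (a + of_nat n) (b + 1) (c + 1) x +
      ((a + of_nat n) * (- ((c - b) / (c * (c + 1))))) * (x * hyp2f1 (a + 1 + of_nat n) (b + 1) (c + 2) x))"
    by (intro poly_bounded_add poly_bounded_mult poly_bounded_const poly_bounded_of_nat poly_bounded_arg IH)
  then show ?case
    by (rule poly_bounded_cong) (simp add: hyp2f1_raise_b[OF raise_b.hyps] add_ac)
qed

section \<open>Averages with respect to Poisson weights\<close>

lemma power_le_exp:
  fixes \<eta> :: real
  assumes "\<eta> > 0"
  obtains C where "C > 0" "\<And>n. (1 + real n) ^ m \<le> C * exp (\<eta> * real n)"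
proof -
  define M where "M = real m + 1"
  have M: "M > 0" by (simp add: M_def)
  show thesis
  proof (rule that[of "(M / \<eta>) ^ m * exp \<eta>"])
    show "(M / \<eta>) ^ m * exp \<eta> > 0" using assms M by simp
    fix n
    let ?t = "\<eta> * (1 + real n) / M"
    have "?t \<le> exp ?t" using exp_ge_add_one_self[of ?t] by linarith
    then have "?t ^ m \<le> exp ?t ^ m"
      using assms M by (intro power_mono) auto
    also have "exp ?t ^ m = exp (\<eta> * (1 + real n) * (m / M))"
      by (simp add: mult_ac flip: exp_of_nat_mult)
    also have "\<dots> \<le> exp (\<eta> * (1 + real n) * 1)"
      using assms M by (intro exp_le_cancel_iff[THEN iffD2] mult_left_mono) (auto simp: M_def)
    finally have le: "?t ^ m \<le> exp \<eta> * exp (\<eta> * real n)"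
      by (simp add: distrib_left exp_add)
    have "(1 + real n) ^ m = (M / \<eta>) ^ m * ?t ^ m"
      using assms M by (simp flip: power_mult_distrib)
    also have "\<dots> \<le> (M / \<eta>) ^ m * (exp \<eta> * exp (\<eta> * real n))"
      using assms M by (intro mult_left_mono le) auto
    finally show "(1 + real n) ^ m \<le> (M / \<eta>) ^ m * exp \<eta> * exp (\<eta> * real n)"
      by (simp add: mult_ac)
  qed
qed

lemma exp_minus_le:
  fixes u :: real
  assumes "u \<ge> 0"
  shows "exp (- u) \<le> 1 - u + u\<^sup>2"
proof -
  have "exp (- u) \<le> 1 / (1 + u)"
    using assms exp_ge_add_one_self[of u] by (simp add: exp_minus field_simps)
  also have "1 \<le> (1 - u + u\<^sup>2) * (1 + u)"
    using assms by (simp add: algebra_simps power2_eq_square power3_eq_cube)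
  then have "1 / (1 + u) \<le> 1 - u + u\<^sup>2"
    using assms by (simp add: pos_divide_le_eq)
  finally show ?thesis .
qed

lemma poisson_sums: "(\<lambda>n. exp (t * real n) * (y ^ n / fact n)) sums exp (exp t * y)"
proof -
  have "(\<lambda>n. (exp t * y) ^ n /\<^sub>R fact n) sums exp (exp t * y)"
    by (rule exp_converges)
  moreover have "(exp t * y) ^ n /\<^sub>R fact n = exp (t * real n) * (y ^ n / fact n)" for n
    by (simp add: power_mult_distrib divide_inverse mult_ac flip: exp_of_nat_mult)
  ultimately show ?thesis by simp
qed

text \<open>
  The exponents that arise from the tails of the Poisson weights at relative distance
  \<^term>\<open>4 * \<theta>\<close> from the mean, with tilting parameter \<open>\<theta>\<close> and a factor \<^term>\<open>exp (\<theta>\<^sup>2 * real n)\<close>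
  that absorbs polynomial growth. Up to terms of third order both are
  \<^term>\<open>\<theta>\<^sup>2 + \<theta>\<^sup>2 / 2 - 4 * \<theta>\<^sup>2\<close>, which leaves room for the bound \<^term>\<open>- \<theta>\<^sup>2\<close>.
\<close>

lemma chernoff_exponents:
  fixes \<theta> :: real
  assumes "0 < \<theta>" "\<theta> \<le> 1 / 4"
  shows "exp (\<theta>\<^sup>2 + \<theta>) - 1 - \<theta> * (1 + 4 * \<theta>) \<le> - \<theta>\<^sup>2"
    and "exp (\<theta>\<^sup>2 - \<theta>) - 1 + \<theta> * (1 - 4 * \<theta>) \<le> - \<theta>\<^sup>2"
proof -
  have t2: "\<theta>\<^sup>2 \<le> \<theta> / 4" "0 < \<theta>\<^sup>2"
    using assms mult_left_mono[of \<theta> "1/4" \<theta>] by (auto simp: power2_eq_square)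
  have "exp (\<theta>\<^sup>2 + \<theta>) \<le> 1 + (\<theta>\<^sup>2 + \<theta>) + (\<theta>\<^sup>2 + \<theta>)\<^sup>2"
    using assms t2 by (intro exp_bound; linarith)
  moreover have "(\<theta>\<^sup>2 + \<theta>)\<^sup>2 \<le> (5 / 4 * \<theta>)\<^sup>2"
    using assms t2 by (intro power_mono; linarith)
  moreover have "(5 / 4 * \<theta>)\<^sup>2 = 25 / 16 * \<theta>\<^sup>2"
    by (simp add: power2_eq_square)
  moreover have "\<theta> * (1 + 4 * \<theta>) = \<theta> + 4 * \<theta>\<^sup>2"
    by (simp add: power2_eq_square algebra_simps)
  ultimately show "exp (\<theta>\<^sup>2 + \<theta>) - 1 - \<theta> * (1 + 4 * \<theta>) \<le> - \<theta>\<^sup>2"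
    using t2 by linarith
  have "0 \<le> \<theta> - \<theta>\<^sup>2" using t2 assms by linarith
  then have "exp (\<theta>\<^sup>2 - \<theta>) \<le> 1 - (\<theta> - \<theta>\<^sup>2) + (\<theta> - \<theta>\<^sup>2)\<^sup>2"
    using exp_minus_le[of "\<theta> - \<theta>\<^sup>2"] by simp
  moreover have "(\<theta> - \<theta>\<^sup>2)\<^sup>2 \<le> \<theta>\<^sup>2"
    using assms t2 by (intro power_mono; linarith)
  moreover have "\<theta> * (1 - 4 * \<theta>) = \<theta> - 4 * \<theta>\<^sup>2"
    by (simp add: power2_eq_square algebra_simps)
  ultimately show "exp (\<theta>\<^sup>2 - \<theta>) - 1 + \<theta> * (1 - 4 * \<theta>) \<le> - \<theta>\<^sup>2"
    using t2 by linarith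
qed

text \<open>
  Chernoff's bound. Outside the central window one of
  \<^term>\<open>exp (\<theta> * (real n - y - 4 * \<theta> * y))\<close> and \<^term>\<open>exp (\<theta> * (y - real n - 4 * \<theta> * y))\<close> is at least 1, so both
  may be added as factors; each resulting series sums to an exponential in closed form.
\<close>

lemma poisson_average_bound:
  fixes f :: "nat \<Rightarrow> complex" and y \<theta> \<epsilon> A C :: real
  assumes y: "y \<ge> 1" and \<theta>: "0 < \<theta>" "\<theta> \<le> 1 / 4" and A: "A \<ge> 0" and \<epsilon>: "\<epsilon> \<ge> 0"
    and central: "\<And>n. \<bar>real n - y\<bar> \<le> 4 * \<theta> * y \<Longrightarrow> norm (f n) \<le> \<epsilon>"
    and bound: "\<And>n. norm (f n) \<le> A * ((1 + real n) * y) ^ m"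
    and C: "C > 0" "\<And>n. (1 + real n) ^ m \<le> C * exp (\<theta>\<^sup>2 * real n)"
  shows "summable (\<lambda>n. f n * of_real (y ^ n / fact n))"
    and "norm (\<Sum>n. f n * of_real (y ^ n / fact n)) \<le>
           (\<epsilon> + 2 * A * C * (y ^ m * exp (- \<theta>\<^sup>2 * y))) * exp y"
proof -
  define P where "P = (\<lambda>n. y ^ n / fact n)"
  have P: "P n \<ge> 0" for n using y by (simp add: P_def)
  define B where "B = A * C * y ^ m"
  have B: "B \<ge> 0" using A C y by (simp add: B_def)
  define M where "M = (\<lambda>n. \<epsilon> * P n + (B * exp (- \<theta> * (1 + 4 * \<theta>) * y)) * (exp ((\<theta>\<^sup>2 + \<theta>) * real n) * P n) +
      (B * exp (\<theta> * (1 - 4 * \<theta>) * y)) * (exp ((\<theta>\<^sup>2 - \<theta>) * real n) * P n))"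
  have le: "norm (f n * of_real (P n)) \<le> M n" for n
  proof -
    have "norm (f n) \<le> \<epsilon> + B * exp (- \<theta> * (1 + 4 * \<theta>) * y) * exp ((\<theta>\<^sup>2 + \<theta>) * real n) +
        B * exp (\<theta> * (1 - 4 * \<theta>) * y) * exp ((\<theta>\<^sup>2 - \<theta>) * real n)"
    proof (cases "\<bar>real n - y\<bar> \<le> 4 * \<theta> * y")
      case True
      with central[OF this] B show ?thesis
        by (smt (verit) exp_ge_zero mult_nonneg_nonneg)
    next
      case False
      have "norm (f n) \<le> A * (((1 + real n) * y) ^ m)" by (rule bound)
      also have "\<dots> = A * y ^ m * (1 + real n) ^ m" by (simp add: power_mult_distrib)
      also have "\<dots> \<le> A * y ^ m * (C * exp (\<theta>\<^sup>2 * real n))"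
        using A y by (intro mult_left_mono C) auto
      also have "\<dots> = B * exp (\<theta>\<^sup>2 * real n)" by (simp add: B_def)
      finally have fB: "norm (f n) \<le> B * exp (\<theta>\<^sup>2 * real n)" .
      have e1: "B * exp (- \<theta> * (1 + 4 * \<theta>) * y) * exp ((\<theta>\<^sup>2 + \<theta>) * real n) =
          B * exp (\<theta>\<^sup>2 * real n) * exp (\<theta> * (real n - y - 4 * \<theta> * y))"
        by (simp add: mult.assoc flip: exp_add) (simp add: algebra_simps)
      have e2: "B * exp (\<theta> * (1 - 4 * \<theta>) * y) * exp ((\<theta>\<^sup>2 - \<theta>) * real n) =
          B * exp (\<theta>\<^sup>2 * real n) * exp (\<theta> * (y - real n - 4 * \<theta> * y))"
        by (simp add: mult.assoc flip: exp_add) (simp add: algebra_simps)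
      have "1 \<le> exp (\<theta> * (real n - y - 4 * \<theta> * y)) + exp (\<theta> * (y - real n - 4 * \<theta> * y))"
      proof (cases "real n \<ge> y")
        case True
        then have "0 \<le> \<theta> * (real n - y - 4 * \<theta> * y)" using False \<theta> by simp
        then have "1 \<le> exp (\<theta> * (real n - y - 4 * \<theta> * y))" by simp
        then show ?thesis using exp_ge_zero[of "\<theta> * (y - real n - 4 * \<theta> * y)"] by linarith
      next
        case n: False
        then have "0 \<le> \<theta> * (y - real n - 4 * \<theta> * y)" using False \<theta> by simp
        then have "1 \<le> exp (\<theta> * (y - real n - 4 * \<theta> * y))" by simp
        then show ?thesis using exp_ge_zero[of "\<theta> * (real n - y - 4 * \<theta> * y)"] by linarith
      qed
      then have "B * exp (\<theta>\<^sup>2 * real n) * 1 \<le> B * exp (\<theta>\<^sup>2 * real n) *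
          (exp (\<theta> * (real n - y - 4 * \<theta> * y)) + exp (\<theta> * (y - real n - 4 * \<theta> * y)))"
        using B by (intro mult_left_mono) auto
      with fB \<epsilon> show ?thesis unfolding e1 e2 by (simp add: distrib_left)
    qed
    then have "norm (f n) * P n \<le> (\<epsilon> + B * exp (- \<theta> * (1 + 4 * \<theta>) * y) * exp ((\<theta>\<^sup>2 + \<theta>) * real n) +
        B * exp (\<theta> * (1 - 4 * \<theta>) * y) * exp ((\<theta>\<^sup>2 - \<theta>) * real n)) * P n"
      using P by (rule mult_right_mono)
    then show ?thesis
      using P[of n] by (simp add: norm_mult M_def distrib_right mult.assoc)
  qed
  have "P sums exp y"
    using poisson_sums[of 0 y] by (simp add: P_def)
  then have M_sums: "M sums (\<epsilon> * exp y + (B * exp (- \<theta> * (1 + 4 * \<theta>) * y)) * exp (exp (\<theta>\<^sup>2 + \<theta>) * y) +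
      (B * exp (\<theta> * (1 - 4 * \<theta>) * y)) * exp (exp (\<theta>\<^sup>2 - \<theta>) * y))"
    unfolding M_def P_def
    by (intro sums_add sums_mult poisson_sums) (simp add: P_def)
  have s: "summable (\<lambda>n. norm (f n * of_real (P n)))"
    by (rule summable_comparison_test'[of M 0]) (use M_sums le in \<open>auto simp: sums_iff\<close>)
  then show "summable (\<lambda>n. f n * of_real (y ^ n / fact n))"
    unfolding P_def by (rule summable_norm_cancel)
  have "norm (\<Sum>n. f n * of_real (P n)) \<le> (\<Sum>n. norm (f n * of_real (P n)))"
    by (rule summable_norm[OF s])
  also have "\<dots> \<le> (\<Sum>n. M n)"
    using s M_sums by (intro suminf_le le) (auto simp: sums_iff)
  also have "\<dots> = \<epsilon> * exp y + B * exp (- \<theta> * (1 + 4 * \<theta>) * y + exp (\<theta>\<^sup>2 + \<theta>) * y) +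
      B * exp (\<theta> * (1 - 4 * \<theta>) * y + exp (\<theta>\<^sup>2 - \<theta>) * y)"
    unfolding sums_unique[OF M_sums, symmetric] exp_add by (simp only: mult.assoc)
  also have "\<dots> \<le> \<epsilon> * exp y + B * exp (- \<theta>\<^sup>2 * y + y) + B * exp (- \<theta>\<^sup>2 * y + y)"
  proof -
    have 1: "- \<theta> * (1 + 4 * \<theta>) * y + exp (\<theta>\<^sup>2 + \<theta>) * y \<le> - \<theta>\<^sup>2 * y + y"
      using mult_right_mono[OF chernoff_exponents(1)[OF \<theta>], of y] y by (simp add: algebra_simps)
    have 2: "\<theta> * (1 - 4 * \<theta>) * y + exp (\<theta>\<^sup>2 - \<theta>) * y \<le> - \<theta>\<^sup>2 * y + y"
      using mult_right_mono[OF chernoff_exponents(2)[OF \<theta>], of y] y by (simp add: algebra_simps)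
    from 1 2 show ?thesis using B by (intro add_mono mult_left_mono order_refl) auto
  qed
  also have "\<dots> = (\<epsilon> + 2 * A * C * (y ^ m * exp (- \<theta>\<^sup>2 * y))) * exp y"
    unfolding exp_add B_def by (simp add: algebra_simps)
  finally show "norm (\<Sum>n. f n * of_real (y ^ n / fact n)) \<le>
      (\<epsilon> + 2 * A * C * (y ^ m * exp (- \<theta>\<^sup>2 * y))) * exp y"
    unfolding P_def .
qed

lemma power_times_exp_tendsto_0:
  fixes k :: real
  assumes "k > 0"
  shows "((\<lambda>y. y ^ m * exp (- k * y)) \<longlongrightarrow> 0) at_top"
proof -
  have "filterlim (\<lambda>y. k * y) at_top at_top"
    using assms by (intro filterlim_tendsto_pos_mult_at_top[OF tendsto_const _ filterlim_ident])
  from filterlim_compose[OF tendsto_power_div_exp_0 this]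
  have "((\<lambda>y. (1 / k ^ m) * ((k * y) ^ m / exp (k * y))) \<longlongrightarrow> (1 / k ^ m) * 0) at_top"
    by (intro tendsto_mult tendsto_const)
  moreover have "(1 / k ^ m) * ((k * y) ^ m / exp (k * y)) = y ^ m * exp (- k * y)" for y
    using assms by (simp add: power_mult_distrib exp_minus divide_inverse)
  ultimately show ?thesis by simp
qed

text \<open>
  The Poisson weights \<^term>\<open>y ^ n / fact n\<close> with total mass \<^term>\<open>exp y\<close> concentrate at indices \<open>n\<close> near \<open>y\<close>:
  the average of a function that is close to \<open>K\<close> there and grows at most polynomially
  elsewhere tends to \<open>K\<close>.
\<close>

lemma poisson_average_eventually:
  fixes g :: "nat \<Rightarrow> 'a \<Rightarrow> complex" and y :: "'a \<Rightarrow> real"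
  assumes y: "filterlim y at_top F"
    and central: "\<And>\<epsilon>. \<epsilon> > 0 \<Longrightarrow> \<exists>\<delta>>0. eventually (\<lambda>\<xi>. \<forall>n. \<bar>real n - y \<xi>\<bar> \<le> \<delta> * y \<xi> \<longrightarrow>
                    norm (g n \<xi> - K) \<le> \<epsilon>) F"
    and bound: "eventually (\<lambda>\<xi>. \<forall>n. norm (g n \<xi>) \<le> C * ((1 + real n) * y \<xi>) ^ m) F"
    and "e > 0"
  shows "eventually (\<lambda>\<xi>. summable (\<lambda>n. g n \<xi> * of_real (y \<xi> ^ n / fact n)) \<and>
    dist ((\<Sum>n. g n \<xi> * of_real (y \<xi> ^ n / fact n)) / of_real (exp (y \<xi>))) K < e) F"
proof -
  obtain \<delta> where \<delta>: "\<delta> > 0" and cent: "eventually (\<lambda>\<xi>. \<forall>n. \<bar>real n - y \<xi>\<bar> \<le> \<delta> * y \<xi> \<longrightarrow>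
      norm (g n \<xi> - K) \<le> e / 2) F"
    using central[of "e / 2"] \<open>e > 0\<close> by auto
  \<comment> \<open>Chosen so that the window of relative width 4 * \<theta> lies inside the given one.\<close>
  define \<theta> where "\<theta> = min \<delta> 1 / 4"
  have \<theta>: "0 < \<theta>" "\<theta> \<le> 1 / 4" "4 * \<theta> \<le> \<delta>" using \<delta> by (auto simp: \<theta>_def)
  obtain D where D: "D > 0" "\<And>n. (1 + real n) ^ m \<le> D * exp (\<theta>\<^sup>2 * real n)"
    using power_le_exp[of "\<theta>\<^sup>2" m] \<theta> by auto
  define A where "A = max C 0 + norm K"
  have A: "A \<ge> 0" by (simp add: A_def)
  have "((\<lambda>\<xi>. 2 * A * D * (y \<xi> ^ m * exp (- \<theta>\<^sup>2 * y \<xi>))) \<longlongrightarrow> 2 * A * D * 0) F"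
    using \<theta> by (intro tendsto_mult tendsto_const filterlim_compose[OF power_times_exp_tendsto_0 y]) auto
  then have small: "eventually (\<lambda>\<xi>. 2 * A * D * (y \<xi> ^ m * exp (- \<theta>\<^sup>2 * y \<xi>)) < e / 2) F"
    using \<open>e > 0\<close> by (intro order_tendstoD(2)) auto
  have y1: "eventually (\<lambda>\<xi>. y \<xi> \<ge> 1) F"
    using y by (simp add: filterlim_at_top)
  show ?thesis
    using cent small y1 bound
  proof eventually_elim
    case (elim \<xi>)
    define v where "v = y \<xi>"
    let ?f = "\<lambda>n. g n \<xi> - K"
    have v: "v \<ge> 1" using elim by (simp add: v_def)
    have f_central: "norm (?f n) \<le> e / 2" if "\<bar>real n - v\<bar> \<le> 4 * \<theta> * v" for n
    proof -
      have "4 * \<theta> * v \<le> \<delta> * v" using \<theta> v by (intro mult_right_mono) auto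
      with that elim(1) show ?thesis by (auto simp: v_def)
    qed
    have f_bound: "norm (?f n) \<le> A * ((1 + real n) * v) ^ m" for n
    proof -
      have "1 \<le> (1 + real n) * v" using mult_mono[of 1 "1 + real n" 1 v] v by simp
      then have X: "1 \<le> ((1 + real n) * v) ^ m" by (rule one_le_power)
      have "norm (?f n) \<le> norm (g n \<xi>) + norm K" by (rule norm_triangle_ineq4)
      also have "norm (g n \<xi>) \<le> C * ((1 + real n) * v) ^ m" using elim by (simp add: v_def)
      also have "\<dots> \<le> max C 0 * ((1 + real n) * v) ^ m"
        using v by (intro mult_right_mono) auto
      also have "norm K \<le> norm K * ((1 + real n) * v) ^ m"
        using mult_left_mono[OF X, of "norm K"] by simp
      finally show ?thesis by (simp add: A_def distrib_right)
    qed
    have half: "0 \<le> e / 2" using \<open>e > 0\<close> by simp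
    note PB = poisson_average_bound[OF v \<theta>(1,2) A half f_central f_bound D]
    let ?P = "\<lambda>n. complex_of_real (v ^ n / fact n)"
    have K_sums: "(\<lambda>n. K * ?P n) sums (K * of_real (exp v))"
      using poisson_sums[of 0 v] by (intro sums_mult sums_of_real) simp
    have "(\<lambda>n. ?f n * ?P n + K * ?P n) sums ((\<Sum>n. ?f n * ?P n) + K * of_real (exp v))"
      using summable_sums[OF PB(1)] K_sums by (rule sums_add)
    then have g_sums: "(\<lambda>n. g n \<xi> * ?P n) sums ((\<Sum>n. ?f n * ?P n) + K * of_real (exp v))"
      by (simp only: left_diff_distrib diff_add_cancel)
    have "(\<Sum>n. g n \<xi> * ?P n) / of_real (exp v) - K = (\<Sum>n. ?f n * ?P n) / of_real (exp v)"
      using g_sums by (simp add: sums_iff add_divide_distrib)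
    then have "dist ((\<Sum>n. g n \<xi> * ?P n) / of_real (exp v)) K = norm (\<Sum>n. ?f n * ?P n) / exp v"
      by (simp add: dist_norm norm_divide)
    also have "\<dots> \<le> e / 2 + 2 * A * D * (v ^ m * exp (- \<theta>\<^sup>2 * v))"
      using PB(2) by (simp add: pos_divide_le_eq)
    also have "\<dots> < e" using elim(2) by (simp add: v_def)
    finally show ?case using sums_summable[OF g_sums] by (simp add: v_def)
  qed
qed

lemma
  fixes g :: "nat \<Rightarrow> 'a \<Rightarrow> complex" and y :: "'a \<Rightarrow> real"
  assumes y: "filterlim y at_top F"
    and central: "\<And>\<epsilon>. \<epsilon> > 0 \<Longrightarrow> \<exists>\<delta>>0. eventually (\<lambda>\<xi>. \<forall>n. \<bar>real n - y \<xi>\<bar> \<le> \<delta> * y \<xi> \<longrightarrow>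
                    norm (g n \<xi> - K) \<le> \<epsilon>) F"
    and bound: "eventually (\<lambda>\<xi>. \<forall>n. norm (g n \<xi>) \<le> C * ((1 + real n) * y \<xi>) ^ m) F"
  shows poisson_average_summable:
      "eventually (\<lambda>\<xi>. summable (\<lambda>n. g n \<xi> * of_real (y \<xi> ^ n / fact n))) F"
    and poisson_average_tendsto:
      "((\<lambda>\<xi>. (\<Sum>n. g n \<xi> * of_real (y \<xi> ^ n / fact n)) / of_real (exp (y \<xi>))) \<longlongrightarrow> K) F"
proof -
  note ev = poisson_average_eventually[OF y central bound]
  show "eventually (\<lambda>\<xi>. summable (\<lambda>n. g n \<xi> * of_real (y \<xi> ^ n / fact n))) F"
    using ev[of 1] by (auto elim: eventually_mono)
  show "((\<lambda>\<xi>. (\<Sum>n. g n \<xi> * of_real (y \<xi> ^ n / fact n)) / of_real (exp (y \<xi>))) \<longlongrightarrow> K) F"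
    by (rule tendstoI) (rule eventually_mono[OF ev conjunct2])
qed

section \<open>The Humbert function\<close>

lemma norm_le_poly_bounded:
  assumes "\<And>n x. x \<in> cut_plane \<Longrightarrow> norm (1 - x) \<ge> 2 \<Longrightarrow> norm (f n x) \<le> C * X n x ^ m"
    and "C \<ge> 0" and "\<And>n x. norm (1 - x) \<ge> 2 \<Longrightarrow> 0 \<le> X n x \<and> X n x \<le> norm (1 - x) * (1 + real n)"
  shows "poly_bounded f"
  unfolding poly_bounded_def
proof (intro exI allI ballI impI)
  fix n x assume x: "x \<in> cut_plane" "norm (1 - x) \<ge> 2"
  have "norm (f n x) \<le> C * X n x ^ m" by (rule assms(1)[OF x])
  also have "\<dots> \<le> C * (norm (1 - x) * (1 + real n)) ^ m"
    using assms(2,3) x by (intro mult_left_mono power_mono) auto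
  finally show "norm (f n x) \<le> C * (norm (1 - x) * (1 + real n)) ^ m" .
qed

lemma powr_le_power_nat:
  fixes r :: real
  assumes "r \<ge> 1"
  shows "r powr s \<le> r ^ nat \<lceil>\<bar>s\<bar>\<rceil>"
proof -
  define k where "k = nat \<lceil>\<bar>s\<bar>\<rceil>"
  have "s \<le> real k" unfolding k_def by linarith
  then have "r powr s \<le> r powr real k"
    using assms by (intro powr_mono) auto
  then show ?thesis using assms unfolding k_def[symmetric] by (simp add: powr_realpow)
qed

lemma poly_bounded_powr: "poly_bounded (\<lambda>_ x. (1 - x) powr b)"
proof (rule norm_le_poly_bounded)
  fix n :: nat and x :: complex assume x: "norm (1 - x) \<ge> 2"
  have "norm ((1 - x) powr b) \<le> norm (1 - x) powr Re b * exp (pi * \<bar>Im b\<bar>)"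
    by (rule norm_powr_le)
  also have "\<dots> \<le> norm (1 - x) ^ nat \<lceil>\<bar>Re b\<bar>\<rceil> * exp (pi * \<bar>Im b\<bar>)"
    using x by (intro mult_right_mono powr_le_power_nat) auto
  finally show "norm ((1 - x) powr b) \<le> exp (pi * \<bar>Im b\<bar>) * norm (1 - x) ^ nat \<lceil>\<bar>Re b\<bar>\<rceil>"
    by (simp add: mult.commute)
  show "0 \<le> norm (1 - x) \<and> norm (1 - x) \<le> norm (1 - x) * (1 + real n)"
    by (simp add: mult_le_cancel_left1)
qed simp

lemma poly_bounded_pochhammer_ratio:
  assumes c: "c \<notin> \<int>\<^sub>\<le>\<^sub>0"
  shows "poly_bounded (\<lambda>n _. pochhammer a n / pochhammer c n)"
proof -
  have "Bseq (\<lambda>n. pochhammer a n / pochhammer c n * of_nat n powr (c - a))"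
    using pochhammer_ratio_tendsto[OF c] by (intro convergent_imp_Bseq) (auto simp: convergent_def)
  then obtain B where B: "B > 0" "\<And>n. norm (pochhammer a n / pochhammer c n * of_nat n powr (c - a)) \<le> B"
    by (auto simp: Bseq_def)
  show ?thesis
  proof (rule norm_le_poly_bounded)
    fix n :: nat and x :: complex assume x: "norm (1 - x) \<ge> 2"
    let ?m = "nat \<lceil>\<bar>Re (a - c)\<bar>\<rceil>"
    show "norm (pochhammer a n / pochhammer c n) \<le> (B + 1) * (1 + real n) ^ ?m"
    proof (cases "n = 0")
      case True
      then show ?thesis using B(1) by simp
    next
      case False
      have "of_nat n powr (c - a) * of_nat n powr (a - c) = (1 :: complex)"
        using False by (simp flip: powr_add)
      then have "pochhammer a n / pochhammer c n =
          (pochhammer a n / pochhammer c n * of_nat n powr (c - a)) * of_nat n powr (a - c)"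
        by (simp only: mult.assoc mult_1_right)
      then have "norm (pochhammer a n / pochhammer c n) =
          norm (pochhammer a n / pochhammer c n * of_nat n powr (c - a)) * norm (of_nat n powr (a - c) :: complex)"
        by (metis norm_mult)
      also have "\<dots> \<le> (B + 1) * (1 + real n) ^ ?m"
      proof (intro mult_mono)
        show "norm (pochhammer a n / pochhammer c n * of_nat n powr (c - a)) \<le> B + 1"
          using B(2)[of n] by linarith
        have "norm (of_nat n powr (a - c) :: complex) = real n powr Re (a - c)"
          by (simp add: norm_powr_real_powr)
        also have "\<dots> \<le> real n ^ ?m"
          using False by (intro powr_le_power_nat) auto
        also have "\<dots> \<le> (1 + real n) ^ ?m"
          by (intro power_mono) auto
        finally show "norm (of_nat n powr (a - c) :: complex) \<le> (1 + real n) ^ ?m" .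
      qed (use B in auto)
      finally show ?thesis .
    qed
    show "0 \<le> 1 + real n \<and> 1 + real n \<le> norm (1 - x) * (1 + real n)"
      using mult_right_mono[of 1 "norm (1 - x)" "1 + real n"] x by simp
  qed (use B in simp)
qed

text \<open>
  In this regime \<^term>\<open>norm (1 - x)\<close> is at most a multiple of \<open>y\<close>, which converts polynomial
  growth in \<^term>\<open>norm (1 - x)\<close> into polynomial growth in \<open>y\<close>.
\<close>

lemma psi1_regime_limits:
  shows "filterlim fst (inf at_infinity (principal cut_plane)) (psi1_regime \<gamma>1 \<gamma>2)"
    and "filterlim snd at_top (psi1_regime \<gamma>1 \<gamma>2)"
    and "eventually (\<lambda>(x, y). x \<in> cut_plane \<and> norm (1 - x) \<ge> 2 \<and> y \<ge> 1 \<and>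
           \<gamma>1 * norm (1 - x) \<le> y) (psi1_regime \<gamma>1 \<gamma>2)"
proof -
  let ?S = "{(x, y). x \<in> cut_plane \<and> \<gamma>1 \<le> norm (complex_of_real y / (1 - x)) \<and>
      norm (complex_of_real y / (1 - x)) \<le> \<gamma>2}"
  have fst: "filterlim fst at_infinity (psi1_regime \<gamma>1 \<gamma>2)"
    unfolding psi1_regime_def by (rule filterlim_mono[OF filterlim_fst order_refl inf_le1])
  have snd: "filterlim snd at_top (psi1_regime \<gamma>1 \<gamma>2)"
    unfolding psi1_regime_def by (rule filterlim_mono[OF filterlim_snd order_refl inf_le1])
  have S: "eventually (\<lambda>p. p \<in> ?S) (psi1_regime \<gamma>1 \<gamma>2)"
    unfolding psi1_regime_def eventually_inf_principal by simp
  show "filterlim fst (inf at_infinity (principal cut_plane)) (psi1_regime \<gamma>1 \<gamma>2)"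
    unfolding filterlim_inf filterlim_principal using fst S by (auto elim: eventually_mono)
  show "filterlim snd at_top (psi1_regime \<gamma>1 \<gamma>2)" by (rule snd)
  have "eventually (\<lambda>p. norm (1 - fst p) \<ge> 2) (psi1_regime \<gamma>1 \<gamma>2)"
    using filterlim_compose[OF filterlim_1_minus_at_infinity fst]
    unfolding filterlim_at_infinity[OF order_refl] by simp
  moreover have "eventually (\<lambda>p. snd p \<ge> 1) (psi1_regime \<gamma>1 \<gamma>2)"
    using snd by (simp add: filterlim_at_top)
  ultimately show "eventually (\<lambda>(x, y). x \<in> cut_plane \<and> norm (1 - x) \<ge> 2 \<and> y \<ge> 1 \<and>
           \<gamma>1 * norm (1 - x) \<le> y) (psi1_regime \<gamma>1 \<gamma>2)"
    using S
  proof eventually_elim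
    case (elim p)
    then have pos: "0 < norm (1 - fst p)" by linarith
    have "\<gamma>1 \<le> norm (complex_of_real (snd p) / (1 - fst p))"
      using elim by (auto simp: case_prod_unfold)
    also have "\<dots> = snd p / norm (1 - fst p)"
      using elim by (simp add: norm_divide)
    finally have "\<gamma>1 * norm (1 - fst p) \<le> snd p"
      using pos by (simp add: pos_le_divide_eq)
    with elim show ?case by (auto simp: case_prod_unfold)
  qed
qed

lemma ratio_close_to_1:
  fixes y :: real
  assumes y: "y > 0" and \<delta>: "\<delta> \<le> 1 / 2" and n: "\<bar>real n - y\<bar> \<le> \<delta> * y"
  shows "real n \<ge> y / 2" and "\<bar>y / real n - 1\<bar> \<le> 2 * \<delta>"
proof -
  have "\<delta> * y \<le> 1 / 2 * y" using y \<delta> by (intro mult_right_mono) auto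
  then show n2: "real n \<ge> y / 2" using n by linarith
  then have n0: "real n > 0" using y by linarith
  have "0 \<le> \<delta> * y" using n by linarith
  then have "\<delta> \<ge> 0" using y by (simp add: zero_le_mult_iff)
  then have "\<delta> * y \<le> \<delta> * (2 * real n)" using n2 by (intro mult_left_mono) auto
  then have "\<bar>y - real n\<bar> \<le> 2 * \<delta> * real n" using n by linarith
  moreover have "y / real n - 1 = (y - real n) / real n" using n0 by (simp add: diff_divide_distrib)
  ultimately show "\<bar>y / real n - 1\<bar> \<le> 2 * \<delta>" using n0 by (simp add: pos_divide_le_eq)
qed

text \<open>
  After scaling, the series is a Poisson average of
  \<^term>\<open>pochhammer a n / pochhammer c' n * ((1 - x) powr b * hyp2f1 (a + of_nat n) b c x) * y powr (b + c' - a)\<close>.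
  With \<open>y\<close> replaced by \<open>n\<close> this would tend to the stated constant by \<open>hyp2f1_asymptotic\<close> and
  \<open>pochhammer_ratio_tendsto\<close>; near the mean the remaining factor \<^term>\<open>(y / of_nat n) powr (b + c' - a)\<close> is
  close to 1.
\<close>

lemma humbert_psi1_scaled_tendsto:
  assumes c: "c \<notin> \<int>\<^sub>\<le>\<^sub>0" and c': "c' \<notin> \<int>\<^sub>\<le>\<^sub>0" and ac: "a - c \<notin> \<int>" and \<gamma>1: "\<gamma>1 > 0"
  shows "((\<lambda>(x, y). (1 - x) powr b * of_real y powr (b + c' - a) * humbert_psi1 a b c c' x (of_real y)
            / of_real (exp y))
    \<longlongrightarrow> Gamma c' * rGamma a * (Gamma c * rGamma (c - b))) (psi1_regime \<gamma>1 \<gamma>2)"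
proof -
  define s where "s = b + c' - a"
  define K where "K = Gamma c' * rGamma a * (Gamma c * rGamma (c - b))"
  define h where "h = (\<lambda>n x. pochhammer a n / pochhammer c' n * ((1 - x) powr b * hyp2f1 (a + of_nat n) b c x))"
  define g where "g = (\<lambda>n p. h n (fst p) * complex_of_real (snd p) powr s)"
  have h_lim: "((\<lambda>q. of_nat (fst q) powr s * h (fst q) (snd q)) \<longlongrightarrow> K) large_index_regime"
  proof -
    have "((\<lambda>q. (pochhammer a (fst q) / pochhammer c' (fst q) * of_nat (fst q) powr (c' - a)) *
        (of_nat (fst q) powr b * (1 - snd q) powr b * hyp2f1 (a + of_nat (fst q)) b c (snd q))) \<longlongrightarrow> K)
        large_index_regime"
      unfolding K_def using hyp2f1_asymptotic[OF c, of b a, unfolded case_prod_unfold]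
      by (rule tendsto_mult[OF filterlim_compose[OF pochhammer_ratio_tendsto[OF c']
            filterlim_fst_large_index_regime]])
    moreover have "(pochhammer a n / pochhammer c' n * of_nat n powr (c' - a)) *
        (of_nat n powr b * (1 - x) powr b * hyp2f1 (a + of_nat n) b c x) = of_nat n powr s * h n x" for n x
    proof -
      have "s = (c' - a) + b" by (simp add: s_def)
      then have "of_nat n powr s = of_nat n powr (c' - a) * (of_nat n powr b :: complex)"
        by (simp only: powr_add)
      then show ?thesis by (simp only: h_def mult_ac)
    qed
    ultimately show ?thesis by simp
  qed
  have h_poly: "poly_bounded h"
    unfolding h_def
    by (intro poly_bounded_mult poly_bounded_pochhammer_ratio c' poly_bounded_powr poly_bounded_hyp2f1 c ac)
  then obtain C m where C: "C \<ge> 0" "\<And>n x. x \<in> cut_plane \<Longrightarrow> norm (1 - x) \<ge> 2 \<Longrightarrow>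
     norm (h n x) \<le> C * (norm (1 - x) * (1 + real n)) ^ m"
    using poly_boundedE by blast
  define k where "k = nat \<lceil>\<bar>Re s\<bar>\<rceil>"
  have bound: "eventually (\<lambda>p. \<forall>n. norm (g n p) \<le> (C / \<gamma>1 ^ m) * ((1 + real n) * snd p) ^ (m + k))
      (psi1_regime \<gamma>1 \<gamma>2)"
    using psi1_regime_limits(3)[of \<gamma>1 \<gamma>2]
  proof eventually_elim
    case (elim p)
    obtain x y where p: "p = (x, y)" by force
    have x: "x \<in> cut_plane" "norm (1 - x) \<ge> 2" and y: "y \<ge> 1" and xy: "norm (1 - x) \<le> y / \<gamma>1"
      using elim \<gamma>1 by (auto simp: p pos_le_divide_eq mult.commute)
    have "norm (g n p) \<le> (C / \<gamma>1 ^ m) * ((1 + real n) * y) ^ (m + k)" for n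
    proof -
      have "norm (h n x) \<le> C * (norm (1 - x) * (1 + real n)) ^ m" by (rule C(2)[OF x])
      also have "\<dots> \<le> C * (y / \<gamma>1 * (1 + real n)) ^ m"
        using C(1) xy by (intro mult_left_mono power_mono mult_right_mono) auto
      also have "\<dots> = (C / \<gamma>1 ^ m) * ((1 + real n) * y) ^ m"
        by (simp add: power_mult_distrib power_divide mult_ac)
      finally have 1: "norm (h n x) \<le> (C / \<gamma>1 ^ m) * ((1 + real n) * y) ^ m" .
      have "norm (complex_of_real y powr s) = y powr Re s"
        using y by (simp add: norm_powr_real_powr)
      also have "\<dots> \<le> y ^ k" unfolding k_def by (rule powr_le_power_nat[OF y])
      also have "\<dots> \<le> ((1 + real n) * y) ^ k"
        using y by (intro power_mono) auto
      finally have 2: "norm (complex_of_real y powr s) \<le> ((1 + real n) * y) ^ k" .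
      have "norm (g n p) = norm (h n x) * norm (complex_of_real y powr s)"
        by (simp add: g_def p norm_mult)
      also have "\<dots> \<le> ((C / \<gamma>1 ^ m) * ((1 + real n) * y) ^ m) * ((1 + real n) * y) ^ k"
        using C(1) \<gamma>1 y by (intro mult_mono 1 2) auto
      finally show ?thesis by (simp add: power_add mult.assoc)
    qed
    then show ?case by (simp add: p)
  qed
  have central: "\<exists>\<delta>>0. eventually (\<lambda>p. \<forall>n. \<bar>real n - snd p\<bar> \<le> \<delta> * snd p \<longrightarrow> norm (g n p - K) \<le> \<epsilon>)
      (psi1_regime \<gamma>1 \<gamma>2)" if "\<epsilon> > 0" for \<epsilon>
  proof -
    \<comment> \<open>The ratio y / n is treated as an independent variable tending to 1.\<close>
    let ?R = "large_index_regime \<times>\<^sub>F nhds (1 :: real)"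
    have "((\<lambda>r. complex_of_real (snd r) powr s) \<longlongrightarrow> of_real 1 powr s) ?R"
      by (intro tendsto_intros filterlim_snd) (auto simp: complex_nonpos_Reals_iff)
    then have "((\<lambda>r. (of_nat (fst (fst r)) powr s * h (fst (fst r)) (snd (fst r))) * complex_of_real (snd r) powr s)
        \<longlongrightarrow> K * of_real 1 powr s) ?R"
      by (intro tendsto_mult filterlim_compose[OF h_lim filterlim_fst])
    then have "eventually (\<lambda>r. dist ((of_nat (fst (fst r)) powr s * h (fst (fst r)) (snd (fst r))) *
        complex_of_real (snd r) powr s) K < \<epsilon>) ?R"
      using \<open>\<epsilon> > 0\<close> by (auto dest: tendstoD)
    then obtain Pq Pv where Pq: "eventually Pq large_index_regime" and Pv: "eventually Pv (nhds 1)"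
      and close: "\<And>q v. Pq q \<Longrightarrow> Pv v \<Longrightarrow>
        dist ((of_nat (fst q) powr s * h (fst q) (snd q)) * complex_of_real v powr s) K < \<epsilon>"
      unfolding eventually_prod_filter by auto
    obtain Pn Px where Pn: "eventually Pn at_top" and Px: "eventually Px (inf at_infinity (principal cut_plane))"
      and Pnx: "\<And>n x. Pn n \<Longrightarrow> Px x \<Longrightarrow> Pq (n, x)"
      using Pq unfolding large_index_regime_def eventually_prod_filter by auto
    obtain N where N: "\<And>n. n \<ge> N \<Longrightarrow> Pn n"
      using Pn by (auto simp: eventually_at_top_linorder)
    obtain d where d: "d > 0" "\<And>v. dist v 1 < d \<Longrightarrow> Pv v"
      using Pv by (auto simp: eventually_nhds_metric)
    \<comment> \<open>If n is within \<delta> * y of y, then y / n is within 2 * \<delta> of 1.\<close>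
    define \<delta> where "\<delta> = min (1 / 2) (d / 3)"
    have \<delta>: "\<delta> > 0" "\<delta> \<le> 1 / 2" "2 * \<delta> < d" using d(1) by (auto simp: \<delta>_def min_def)
    have "eventually (\<lambda>p. snd p \<ge> 2 * (real N + 1)) (psi1_regime \<gamma>1 \<gamma>2)"
      using psi1_regime_limits(2) by (simp add: filterlim_at_top)
    moreover have "eventually (\<lambda>p. Px (fst p)) (psi1_regime \<gamma>1 \<gamma>2)"
      by (rule eventually_compose_filterlim[OF Px psi1_regime_limits(1)])
    ultimately have "eventually (\<lambda>p. \<forall>n. \<bar>real n - snd p\<bar> \<le> \<delta> * snd p \<longrightarrow> norm (g n p - K) \<le> \<epsilon>)
      (psi1_regime \<gamma>1 \<gamma>2)"
    proof eventually_elim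
      case (elim p)
      obtain x y where p: "p = (x, y)" by force
      have y: "y \<ge> 2 * (real N + 1)" "y > 0" and x: "Px x" using elim by (auto simp: p)
      have "norm (g n p - K) \<le> \<epsilon>" if n: "\<bar>real n - y\<bar> \<le> \<delta> * y" for n
      proof -
        note rc = ratio_close_to_1[OF y(2) \<delta>(2) n]
        have n1: "real n \<ge> real N + 1" using order_trans[OF _ rc(1), of "real N + 1"] y(1) by simp
        have "Pq (n, x)" using n1 by (intro Pnx N x) simp
        moreover have "Pv (y / real n)" using rc(2) \<delta>(3) by (intro d(2)) (simp add: dist_norm)
        ultimately have "dist ((of_nat n powr s * h n x) * complex_of_real (y / real n) powr s) K < \<epsilon>"
          using close[of "(n, x)" "y / real n"] by simp
        moreover have "of_nat n powr s * complex_of_real (y / real n) powr s = complex_of_real y powr s"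
          using n1 y(2) by (subst powr_times_real[symmetric]) auto
        then have "(of_nat n powr s * h n x) * complex_of_real (y / real n) powr s = g n p"
          by (simp add: g_def p mult_ac)
        ultimately show ?thesis by (simp add: dist_norm)
      qed
      then show ?case by (simp add: p)
    qed
    with \<delta>(1) show ?thesis by blast
  qed
  have avg: "((\<lambda>p. (\<Sum>n. g n p * of_real (snd p ^ n / fact n)) / of_real (exp (snd p))) \<longlongrightarrow> K)
      (psi1_regime \<gamma>1 \<gamma>2)"
    by (rule poisson_average_tendsto[OF psi1_regime_limits(2) central bound])
  have summable_ev: "eventually (\<lambda>p. summable (\<lambda>n. g n p * of_real (snd p ^ n / fact n)))
      (psi1_regime \<gamma>1 \<gamma>2)"
    by (rule poisson_average_summable[OF psi1_regime_limits(2) central bound])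
  have "eventually (\<lambda>p. (\<Sum>n. g n p * of_real (snd p ^ n / fact n)) / of_real (exp (snd p)) =
      (case p of (x, y) \<Rightarrow> (1 - x) powr b * of_real y powr s * humbert_psi1 a b c c' x (of_real y)
            / of_real (exp y))) (psi1_regime \<gamma>1 \<gamma>2)"
    using psi1_regime_limits(3)[of \<gamma>1 \<gamma>2] summable_ev
  proof eventually_elim
    case (elim p)
    obtain x y where p: "p = (x, y)" by force
    have nz: "(1 - x) powr b * of_real y powr s \<noteq> 0"
      using elim by (auto simp: p cut_plane_def)
    have "(\<Sum>n. g n p * of_real (snd p ^ n / fact n)) =
        (\<Sum>n. ((1 - x) powr b * of_real y powr s) *
          (pochhammer a n / pochhammer c' n * hyp2f1 (a + of_nat n) b c x * (of_real y ^ n / fact n)))"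
      by (simp add: g_def h_def p mult_ac)
    also have "\<dots> = (1 - x) powr b * of_real y powr s * humbert_psi1 a b c c' x (of_real y)"
      unfolding humbert_psi1_def
    proof (rule suminf_mult)
      have "summable (\<lambda>n. ((1 - x) powr b * of_real y powr s) *
          (pochhammer a n / pochhammer c' n * hyp2f1 (a + of_nat n) b c x * (of_real y ^ n / fact n)))"
        using elim(2) by (simp add: g_def h_def p mult_ac)
      with nz show "summable (\<lambda>n. pochhammer a n / pochhammer c' n * hyp2f1 (a + of_nat n) b c x *
          (of_real y ^ n / fact n))"
        by (simp only: summable_cmult_iff simp_thms)
    qed
    finally show ?case by (simp add: p)
  qed
  then show ?thesis
    using avg unfolding s_def K_def by (rule tendsto_eventually_eq[OF _ refl, rotated])
qed

text \<open>
  Away from the cut the principal powers of \<^term>\<open>of_real y / (1 - x)\<close> split, so the main term is the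
  reciprocal of the scaling used above, up to the exponential.
\<close>

lemma main_term_eq:
  assumes x: "x \<in> cut_plane" and y: "y > 0"
  shows "(of_real y / (1 - x)) powr b * of_real y powr (a - 2 * b - c') * exp (of_real y) *
           ((1 - x) powr b * of_real y powr (b + c' - a)) = exp (of_real y)"
proof -
  have w: "1 - x \<noteq> 0" "1 - x \<notin> \<real>\<^sub>\<le>\<^sub>0" using x cut_plane_iff[of x] by (auto simp: cut_plane_def)
  have "Ln (of_real y * inverse (1 - x)) = of_real (ln y) - Ln (1 - x)"
    using w y by (subst Ln_times_of_real) (auto simp: Ln_inverse Ln_of_real)
  then have "(of_real y / (1 - x)) powr b = exp (b * (of_real (ln y) - Ln (1 - x)))"
    using w y by (simp add: powr_def divide_inverse)
  then have "(of_real y / (1 - x)) powr b * of_real y powr (a - 2 * b - c') *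
           ((1 - x) powr b * of_real y powr (b + c' - a)) =
      exp (b * (of_real (ln y) - Ln (1 - x)) + (a - 2 * b - c') * of_real (ln y) +
        (b * Ln (1 - x) + (b + c' - a) * of_real (ln y)))"
    using w y unfolding exp_add by (simp add: powr_def Ln_of_real)
  also have "\<dots> = 1" by (simp add: algebra_simps)
  finally show ?thesis by (simp add: mult_ac)
qed

theorem theorem3p6:
  fixes a b c c' :: complex and \<gamma>1 \<gamma>2 :: real
  assumes "c \<notin> \<int>\<^sub>\<le>\<^sub>0" and "c' \<notin> \<int>\<^sub>\<le>\<^sub>0"
    and "a - b \<notin> \<int>" and "a - c \<notin> \<int>"
    and "Re (c - b) > 0"
    and "0 < \<gamma>1" and "\<gamma>1 \<le> \<gamma>2"
  shows "(a \<notin> \<int>\<^sub>\<le>\<^sub>0 \<longrightarrow>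
           (\<lambda>(x, y). humbert_psi1 a b c c' x (of_real y)) \<sim>[psi1_regime \<gamma>1 \<gamma>2]
             (\<lambda>(x, y). Gamma c * Gamma c' / (Gamma a * Gamma (c - b)) *
                (of_real y / (1 - x)) powr b * of_real y powr (a - 2 * b - c') * exp (of_real y)))
       \<and> (a \<in> \<int>\<^sub>\<le>\<^sub>0 \<longrightarrow>
           (\<lambda>(x, y). humbert_psi1 a b c c' x (of_real y)) \<in> o[psi1_regime \<gamma>1 \<gamma>2](
             \<lambda>(x, y). (of_real y / (1 - x)) powr b * of_real y powr (a - 2 * b - c') *
                exp (of_real y)))"
proof -
  let ?\<Psi> = "\<lambda>p. humbert_psi1 a b c c' (fst p) (of_real (snd p))"
  define M :: "complex \<times> real \<Rightarrow> complex" where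
    "M = (\<lambda>p. (of_real (snd p) / (1 - fst p)) powr b * of_real (snd p) powr (a - 2 * b - c') *
               exp (of_real (snd p)))"
  define K where "K = Gamma c' * rGamma a * (Gamma c * rGamma (c - b))"
  have M_nz: "eventually (\<lambda>p. M p \<noteq> 0) (psi1_regime \<gamma>1 \<gamma>2)"
    using psi1_regime_limits(3)[of \<gamma>1 \<gamma>2] by eventually_elim (auto simp: M_def cut_plane_def)
  have ratio: "((\<lambda>p. ?\<Psi> p / M p) \<longlongrightarrow> K) (psi1_regime \<gamma>1 \<gamma>2)"
  proof (rule tendsto_eventually_eq[OF humbert_psi1_scaled_tendsto[OF assms(1,2,4,6), of b \<gamma>2]])
    show "eventually (\<lambda>p. (case p of (x, y) \<Rightarrow> (1 - x) powr b * of_real y powr (b + c' - a) *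
        humbert_psi1 a b c c' x (of_real y) / of_real (exp y)) = ?\<Psi> p / M p) (psi1_regime \<gamma>1 \<gamma>2)"
      using psi1_regime_limits(3)[of \<gamma>1 \<gamma>2] M_nz
    proof eventually_elim
      case (elim p)
      obtain x y where p: "p = (x, y)" by force
      have "M p * ((1 - x) powr b * of_real y powr (b + c' - a)) = exp (of_real y)"
        using main_term_eq[of x y b a c'] elim by (simp add: M_def p)
      then have "exp (of_real y) / M p = (1 - x) powr b * of_real y powr (b + c' - a)"
        using elim(2) by (simp add: divide_eq_eq mult.commute)
      then have "(1 - x) powr b * of_real y powr (b + c' - a) * ?\<Psi> p / exp (of_real y) =
          exp (of_real y) / M p * ?\<Psi> p / exp (of_real y)"
        by simp
      then show ?case by (simp add: p exp_of_real)
    qed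
  qed (simp add: K_def)
  show ?thesis
  proof (intro conjI impI)
    assume a: "a \<notin> \<int>\<^sub>\<le>\<^sub>0"
    have cb: "c - b \<notin> \<int>\<^sub>\<le>\<^sub>0"
    proof
      assume "c - b \<in> \<int>\<^sub>\<le>\<^sub>0"
      then obtain n where "c - b = - of_nat n" by (elim nonpos_Ints_cases')
      then have "Re (c - b) = - real n" by simp
      with assms(5) show False by simp
    qed
    have K_eq: "K = Gamma c * Gamma c' / (Gamma a * Gamma (c - b))"
      by (simp add: K_def Gamma_def field_simps)
    have "K \<noteq> 0"
      using a cb assms(1,2) by (simp add: K_eq Gamma_eq_zero_iff)
    have "((\<lambda>p. (1 / K) * (?\<Psi> p / M p)) \<longlongrightarrow> (1 / K) * K) (psi1_regime \<gamma>1 \<gamma>2)"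
      by (intro tendsto_mult tendsto_const ratio)
    then have "((\<lambda>p. ?\<Psi> p / (K * M p)) \<longlongrightarrow> 1) (psi1_regime \<gamma>1 \<gamma>2)"
      using \<open>K \<noteq> 0\<close> by simp
    then have "?\<Psi> \<sim>[psi1_regime \<gamma>1 \<gamma>2] (\<lambda>p. K * M p)"
      by (rule asymp_equivI')
    then show "(\<lambda>(x, y). humbert_psi1 a b c c' x (of_real y)) \<sim>[psi1_regime \<gamma>1 \<gamma>2]
        (\<lambda>(x, y). Gamma c * Gamma c' / (Gamma a * Gamma (c - b)) *
           (of_real y / (1 - x)) powr b * of_real y powr (a - 2 * b - c') * exp (of_real y))"
      unfolding case_prod_unfold M_def K_eq by (simp only: mult.assoc)
  next
    assume "a \<in> \<int>\<^sub>\<le>\<^sub>0"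
    then have "K = 0" by (simp add: K_def rGamma_eq_zero_iff)
    then have "?\<Psi> \<in> o[psi1_regime \<gamma>1 \<gamma>2](M)"
      using ratio M_nz by (intro smalloI_tendsto) auto
    then show "(\<lambda>(x, y). humbert_psi1 a b c c' x (of_real y)) \<in> o[psi1_regime \<gamma>1 \<gamma>2](
        \<lambda>(x, y). (of_real y / (1 - x)) powr b * of_real y powr (a - 2 * b - c') * exp (of_real y))"
      unfolding case_prod_unfold M_def .
  qed
qed

end
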